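(* Let $d\ge1$ and let $\Pi$ be an LCL on $\mathbb{Z}^d$. Then $\Pi\in\mathsf{ULOCAL}(O(\log^* 1/\varepsilon))$ if and only if $\Pi\in\mathsf{LOCAL}(O(\log^* n))$.
   Context: Grid and LCLs. $\mathbb{Z}^d$ denotes the infinite grid: the Cayley graph of the group $\mathbb{Z}^d$ with respect to the standard generators, each edge being oriented and labelled by its generator (isomorphisms preserve this structure). $\mathcal B(v,r)$ is the ball of radius $r$ around $v$ in graph distance. A locally checkable problem (LCL) on $\mathbb{Z}^d$ is $\Pi=(\Sigma_{in},\Sigma_{out},t,\mathcal P)$, where $\Sigma_{in},\Sigma_{out}$ are finite sets, $t\in\mathbb N$, and $\mathcal P$ is a set of (isomorphism types of) rooted grids of radius $t$ with each vertex labelled by one label of $\Sigma_{in}$ and one of $\Sigma_{out}$. A labelling of the vertices of a graph by $\Sigma_{in}\times\Sigma_{out}$ is a $\Pi$-coloring if the $t$-hop neighborhood of every vertex is in $\mathcal P$. Uniform local algorithms. A uniform local algorithm is a pair $\mathcal A=(\mathcal C,f)$, where $\mathcal C$ is a collection of rooted finite-radius neighborhoods in $\mathbb{Z}^d$ with vertices labelled by $\Sigma_{in}$ and by reals in $[0,1]$, and $f:\mathcal C\to\Sigma_{out}$ is measurable. It is run on $\Sigma_{in}$-labelled $\mathbb{Z}^d$ whose vertices carry independent uniform labels from $[0,1]$: each vertex explores balls of radius $0,1,2,\dots$ around itself until the labelled ball lies in $\mathcal C$, and then outputs the value of $f$. The coding radius $R_{\mathcal A}$ is the minimal radius needed; $\mathrm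 P(R_{\mathcal A}>r)$ denotes the supremum over all $\Sigma_{in}$-labellings of $\mathcal B(v,r)$ of the probability that $v$ has to look further than $r$. $\mathcal A$ solves $\Pi$ if for every $\Sigma_{in}$-labelling it produces a $\Pi$-coloring with probability $1$. $\mathcal A$ has uniform complexity $t(\varepsilon)$ if $\mathrm P(R_{\mathcal A}>t(\varepsilon))\le\varepsilon$ for all sufficiently small $\varepsilon>0$. $\mathsf{ULOCAL}(t(\varepsilon))$ is the class of LCLs solved by a uniform local algorithm of uniform complexity $t(\varepsilon)$; $\mathsf{ULOCAL}(O(g))$ means complexity $Cg(\varepsilon)$ for some constant $C$. Local algorithms. A deterministic local algorithm of complexity $f(n)$ is a function taking $n$ and a rooted grid of radius $f(n)$ labelled by natural numbers (identifiers) and by $\Sigma_{in}$, and outputting a label from $\Sigma_{out}$. It is run on finite $d$-dimensional tori with $n$ vertices (side lengths $\Theta(n^{1/d})$, edges oriented and labelled by generators) whose vertices carry unique identifiers from $\{1,\dots,n^{O(1)}\}$ and input labels, by applying the function to the $f(n)$-hop neighborhood of every vertex. It solves $\Pi$ if it always produces a $\Pi$-coloring ($n$ large enough that the relevant balls of the torus are isomorphic to balls of $\mathbb{Z}^d$). $\mathsf{LOCAL}(f(n))$ is the class of LCLs solved by such an algorithm of complexity $f(n)$. $\log^* x$ is the number of times $\log_2$ must be iterated, starting from $x$, to reach a value at most $1$. *)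

theory Defs
  imports "HOL-Probability.Probability" "HOL-Library.Landau_Symbols"
begin

section \<open>Graphs with oriented edges labelled by the generators\<close>

text \<open>The grid of dimension \<open>d\<close> lives on the type \<^typ>\<open>int ^ 'd\<close> with \<open>d = CARD('d)\<close>; index
  types are nonempty, so \<open>d \<ge> 1\<close>. The set \<open>arcs G i\<close> holds the oriented edges labelled by the
  \<open>i\<close>-th generator.\<close>

record ('d, 'v) lgraph =
  verts :: "'v set"
  arcs :: "'d \<Rightarrow> ('v \<times> 'v) set"

definition adj :: "('d, 'v) lgraph \<Rightarrow> ('v \<times> 'v) set" where
  "adj G = (\<Union>i. arcs G i \<union> (arcs G i)\<inverse>)"

definition gball :: "('d, 'v) lgraph \<Rightarrow> 'v \<Rightarrow> nat \<Rightarrow> 'v set" where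
  "gball G v r = {w \<in> verts G. \<exists>k\<le>r. (v, w) \<in> adj G ^^ k}"

definition zgrid :: "('d::finite, int ^ 'd) lgraph" where
  "zgrid = \<lparr>verts = UNIV, arcs = (\<lambda>i. {(x, x + axis i 1) | x. True})\<rparr>"

definition reduce :: "('d \<Rightarrow> nat) \<Rightarrow> int ^ 'd \<Rightarrow> int ^ 'd::finite" where
  "reduce m x = (\<chi> i. x $ i mod int (m i))"

definition torus :: "('d \<Rightarrow> nat) \<Rightarrow> ('d::finite, int ^ 'd) lgraph" where
  "torus m = (let V = {x. \<forall>i. 0 \<le> x $ i \<and> x $ i < int (m i)} in
     \<lparr>verts = V, arcs = (\<lambda>i. {(x, reduce m (x + axis i 1)) | x. x \<in> V})\<rparr>)"

text \<open>Isomorphisms between the (induced) ball of radius \<open>r\<close> around the origin of the grid and the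
  ball of radius \<open>r\<close> around \<open>v\<close>, preserving root, orientation and generators.\<close>

definition ball_iso ::
  "('d::finite, 'v) lgraph \<Rightarrow> 'v \<Rightarrow> nat \<Rightarrow> (int ^ 'd \<Rightarrow> 'v) \<Rightarrow> bool" where
  "ball_iso G v r \<phi> \<longleftrightarrow>
     bij_betw \<phi> (gball zgrid 0 r) (gball G v r) \<and> \<phi> 0 = v \<and>
     (\<forall>i. \<forall>x \<in> gball zgrid 0 r. \<forall>y \<in> gball zgrid 0 r.
        (x, y) \<in> arcs zgrid i \<longleftrightarrow> (\<phi> x, \<phi> y) \<in> arcs G i)"

definition grid_like :: "('d::finite, 'v) lgraph \<Rightarrow> 'v \<Rightarrow> nat \<Rightarrow> bool" where
  "grid_like G v r \<longleftrightarrow> (\<exists>\<phi>. ball_iso G v r \<phi>)"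

text \<open>A labelled rooted grid of radius \<open>r\<close> has no nontrivial automorphisms, so its isomorphism type
  is represented by the labelling, extensional on \<open>gball zgrid 0 r\<close>, that it induces there. The
  value of \<open>nbhd G lab v r\<close> is meaningful only if \<open>grid_like G v r\<close>; for the grid and for tori it
  does not depend on the choice (\<open>nbhd_zgrid\<close> and \<open>nbhd_torus\<close> below).\<close>

definition nbhd ::
  "('d::finite, 'v) lgraph \<Rightarrow> ('v \<Rightarrow> 'l) \<Rightarrow> 'v \<Rightarrow> nat \<Rightarrow> (int ^ 'd \<Rightarrow> 'l)" where
  "nbhd G lab v r = restrict (lab \<circ> (SOME \<phi>. ball_iso G v r \<phi>)) (gball zgrid 0 r)"


section \<open>Locally checkable problems\<close>

record ('d, 'i, 'o) lcl =
  in_labels :: "'i set"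
  out_labels :: "'o set"
  radius :: nat
  allowed :: "(int ^ 'd \<Rightarrow> 'i \<times> 'o) set"

definition is_lcl :: "('d::finite, 'i, 'o) lcl \<Rightarrow> bool" where
  "is_lcl L \<longleftrightarrow> finite (in_labels L) \<and> finite (out_labels L) \<and>
     allowed L \<subseteq> (gball zgrid 0 (radius L) \<rightarrow>\<^sub>E in_labels L \<times> out_labels L)"

definition is_coloring ::
  "('d::finite, 'i, 'o) lcl \<Rightarrow> ('d, 'v) lgraph \<Rightarrow> ('v \<Rightarrow> 'i \<times> 'o) \<Rightarrow> bool" where
  "is_coloring L G lab \<longleftrightarrow>
     (\<forall>v \<in> verts G. lab v \<in> in_labels L \<times> out_labels L \<and>
        grid_like G v (radius L) \<and> nbhd G lab v (radius L) \<in> allowed L)"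

definition log_star :: "real \<Rightarrow> nat" where
  "log_star x = (LEAST k. (log 2 ^^ k) x \<le> 1)"


section \<open>Uniform local algorithms\<close>

definition unif01 :: "real measure" where
  "unif01 = restrict_space lborel {0..1}"

definition nbhd_space :: "'i set \<Rightarrow> nat \<Rightarrow> (int ^ 'd::finite \<Rightarrow> 'i \<times> real) measure" where
  "nbhd_space S r = (\<Pi>\<^sub>M x \<in> gball zgrid 0 r. count_space S \<Otimes>\<^sub>M unif01)"

text \<open>The collection \<open>\<C>\<close> and the function \<open>f\<close> are split according to the radius, since an
  extensional function does not determine the ball it is meant to live on.\<close>

record ('d, 'i, 'o) ualg =
  stops :: "nat \<Rightarrow> (int ^ 'd \<Rightarrow> 'i \<times> real) set"
  rule :: "nat \<Rightarrow> (int ^ 'd \<Rightarrow> 'i \<times> real) \<Rightarrow> 'o"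

definition is_ualg :: "'i set \<Rightarrow> 'o set \<Rightarrow> ('d::finite, 'i, 'o) ualg \<Rightarrow> bool" where
  "is_ualg S T A \<longleftrightarrow> (\<forall>r. stops A r \<in> sets (nbhd_space S r) \<and>
     rule A r \<in> restrict_space (nbhd_space S r) (stops A r) \<rightarrow>\<^sub>M count_space T)"

definition coding_radius ::
  "('d::finite, 'i, 'o) ualg \<Rightarrow> (int ^ 'd \<Rightarrow> 'i \<times> real) \<Rightarrow> int ^ 'd \<Rightarrow> enat" where
  "coding_radius A \<omega> v = (INF r \<in> {r. nbhd zgrid \<omega> v r \<in> stops A r}. enat r)"

definition uoutput ::
  "('d::finite, 'i, 'o) ualg \<Rightarrow> (int ^ 'd \<Rightarrow> 'i \<times> real) \<Rightarrow> int ^ 'd \<Rightarrow> 'o" where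
  "uoutput A \<omega> v = (let r = the_enat (coding_radius A \<omega> v) in rule A r (nbhd zgrid \<omega> v r))"

definition iid :: "(int ^ 'd::finite \<Rightarrow> real) measure" where
  "iid = (\<Pi>\<^sub>M v \<in> UNIV. unif01)"

text \<open>The supremum below is over labellings of the whole grid: whether the coding radius of the
  origin exceeds \<open>r\<close> depends only on the ball of radius \<open>r\<close>. By translation invariance nothing
  changes if the origin is replaced by another vertex.\<close>

definition prob_beyond :: "'i set \<Rightarrow> ('d::finite, 'i, 'o) ualg \<Rightarrow> nat \<Rightarrow> ennreal" where
  "prob_beyond S A r = (SUP \<sigma> \<in> UNIV \<rightarrow> S.
     emeasure iid {u \<in> space iid. coding_radius A (\<lambda>v. (\<sigma> v, u v)) 0 > enat r})"

definition usolves :: "('d::finite, 'i, 'o) ualg \<Rightarrow> ('d, 'i, 'o) lcl \<Rightarrow> bool" where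
  "usolves A L \<longleftrightarrow> (\<forall>\<sigma> \<in> UNIV \<rightarrow> in_labels L. AE u in iid.
     let \<omega> = (\<lambda>v. (\<sigma> v, u v)) in
       (\<forall>v. coding_radius A \<omega> v < \<infinity>) \<and>
       is_coloring L zgrid (\<lambda>v. (\<sigma> v, uoutput A \<omega> v)))"

text \<open>As coding radii are integers, exceeding \<open>t \<epsilon>\<close> means exceeding its integer part.\<close>

definition ULOCAL :: "(real \<Rightarrow> real) \<Rightarrow> ('d::finite, 'i, 'o) lcl set" where
  "ULOCAL t = {L. is_lcl L \<and> (\<exists>A. is_ualg (in_labels L) (out_labels L) A \<and> usolves A L \<and>
     (\<forall>\<^sub>F \<epsilon> in at_right 0. prob_beyond (in_labels L) A (nat \<lfloor>t \<epsilon>\<rfloor>) \<le> ennreal \<epsilon>))}"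

definition ULOCAL_O :: "(real \<Rightarrow> real) \<Rightarrow> ('d::finite, 'i, 'o) lcl set" where
  "ULOCAL_O g = (\<Union>C \<in> {0<..}. ULOCAL (\<lambda>\<epsilon>. C * g \<epsilon>))"


section \<open>Deterministic local algorithms\<close>

text \<open>The constant \<open>K\<close> is the one implicit in side lengths \<open>\<Theta>(n\<^bsup>1/d\<^esup>)\<close>, and \<open>k\<close> the exponent in the
  range of identifiers \<open>{1..n\<^bsup>O(1)\<^esup>}\<close>; both are parameters of the model. The algorithm receives
  \<open>n\<close> and the neighbourhood of radius \<open>f n\<close>, whose labels are pairs of an identifier and an
  input label.\<close>

definition balanced :: "real \<Rightarrow> ('d::finite \<Rightarrow> nat) \<Rightarrow> bool" where
  "balanced K m \<longleftrightarrow> (\<forall>i. m i > 0 \<and>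
     (let s = real (card (verts (torus m))) powr (1 / real CARD('d)) in
        s / K \<le> real (m i) \<and> real (m i) \<le> K * s))"

definition is_dalg ::
  "'i set \<Rightarrow> 'o set \<Rightarrow> (nat \<Rightarrow> nat) \<Rightarrow> (nat \<Rightarrow> (int ^ 'd::finite \<Rightarrow> nat \<times> 'i) \<Rightarrow> 'o) \<Rightarrow> bool" where
  "is_dalg S T f A \<longleftrightarrow> (\<forall>n. A n \<in> (gball zgrid 0 (f n) \<rightarrow>\<^sub>E UNIV \<times> S) \<rightarrow> T)"

definition dsolves ::
  "real \<Rightarrow> nat \<Rightarrow> (nat \<Rightarrow> nat) \<Rightarrow> (nat \<Rightarrow> (int ^ 'd::finite \<Rightarrow> nat \<times> 'i) \<Rightarrow> 'o)
     \<Rightarrow> ('d, 'i, 'o) lcl \<Rightarrow> bool" where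
  "dsolves K k f A L \<longleftrightarrow>
     (\<forall>m ident \<sigma>. let G = torus m; n = card (verts G) in
        balanced K m \<and>
        (\<forall>v \<in> verts G. grid_like G v (f n) \<and> grid_like G v (radius L)) \<and>
        inj_on ident (verts G) \<and> ident ` verts G \<subseteq> {1..n ^ k} \<and>
        \<sigma> \<in> verts G \<rightarrow> in_labels L \<longrightarrow>
        is_coloring L G (\<lambda>v. (\<sigma> v, A n (nbhd G (\<lambda>w. (ident w, \<sigma> w)) v (f n)))))"

definition LOCAL :: "real \<Rightarrow> nat \<Rightarrow> (nat \<Rightarrow> nat) \<Rightarrow> ('d::finite, 'i, 'o) lcl set" where
  "LOCAL K k f = {L. is_lcl L \<and>
     (\<exists>A. is_dalg (in_labels L) (out_labels L) f A \<and> dsolves K k f A L)}"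

definition LOCAL_O :: "real \<Rightarrow> nat \<Rightarrow> (nat \<Rightarrow> real) \<Rightarrow> ('d::finite, 'i, 'o) lcl set" where
  "LOCAL_O K k g = (\<Union>f \<in> {f. (\<lambda>n. real (f n)) \<in> O(g)}. LOCAL K k f)"


section \<open>Neighbourhoods in the grid and in tori\<close>

lemma in_arcs_zgrid: "(x, y) \<in> arcs zgrid i \<longleftrightarrow> y = x + axis i 1"
  by (auto simp: zgrid_def)

lemma in_arcs_torus:
  "(x, y) \<in> arcs (torus m) i \<longleftrightarrow> x \<in> verts (torus m) \<and> y = reduce m (x + axis i 1)"
  by (auto simp: torus_def Let_def)

lemma zero_in_gball_zgrid: "0 \<in> gball zgrid 0 r"
  by (auto simp: gball_def zgrid_def intro!: exI[of _ 0])

lemma gball_zgrid_step: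
  assumes "(0, x) \<in> adj zgrid ^^ k" "k \<le> r"
  shows "x \<in> gball zgrid 0 r"
  using assms by (auto simp: gball_def zgrid_def)

lemma reduce_id: "x \<in> verts (torus m) \<Longrightarrow> reduce m x = x"
  by (simp add: torus_def reduce_def vec_eq_iff)

lemma reduce_add: "reduce m (reduce m x + y) = reduce m (x + y)"
  by (simp add: reduce_def vec_eq_iff mod_simps)

lemma reduce_diff: "reduce m (reduce m x - y) = reduce m (x - y)"
  by (simp add: reduce_def vec_eq_iff mod_simps)

text \<open>Both kinds of graphs at once: \<open>p\<close> is the identity or the reduction modulo the sides.\<close>

lemma ball_iso_unique:
  fixes p :: "int ^ 'd::finite \<Rightarrow> int ^ 'd"
  assumes iso: "ball_iso G v r \<phi>" and v: "v \<in> verts G"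
    and fwd: "\<And>i x y. (x, y) \<in> arcs G i \<Longrightarrow> x \<in> verts G \<and> y = p (x + axis i 1)"
    and id: "\<And>x. x \<in> verts G \<Longrightarrow> p x = x"
    and add: "\<And>x y. p (p x + y) = p (x + y)" and diff: "\<And>x y. p (p x - y) = p (x - y)"
    and x: "x \<in> gball zgrid 0 r"
  shows "\<phi> x = p (v + x)"
proof -
  have "\<phi> x = p (v + x)" if "(0, x) \<in> adj zgrid ^^ k" "k \<le> r" for k x
    using that
  proof (induction k arbitrary: x)
    case 0
    then show ?case using iso id[OF v] by (simp add: ball_iso_def)
  next
    case (Suc k)
    then obtain z where z: "(0, z) \<in> adj zgrid ^^ k" "(z, x) \<in> adj zgrid" by auto
    have IH: "\<phi> z = p (v + z)" using Suc z by simp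
    have zb: "z \<in> gball zgrid 0 r" using gball_zgrid_step[OF z(1)] Suc.prems by simp
    have xb: "x \<in> gball zgrid 0 r" using gball_zgrid_step[OF Suc.prems(1)] Suc.prems by simp
    from z(2) obtain i where "(z, x) \<in> arcs zgrid i \<or> (x, z) \<in> arcs zgrid i"
      by (auto simp: adj_def)
    then show ?case
    proof
      assume a: "(z, x) \<in> arcs zgrid i"
      then have "(\<phi> z, \<phi> x) \<in> arcs G i" using iso zb xb by (auto simp: ball_iso_def)
      then have "\<phi> x = p (p (v + z) + axis i 1)" using fwd IH by metis
      then show ?thesis using a add by (simp add: in_arcs_zgrid add.assoc)
    next
      assume a: "(x, z) \<in> arcs zgrid i"
      then have "(\<phi> x, \<phi> z) \<in> arcs G i" using iso zb xb by (auto simp: ball_iso_def)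
      then have b: "\<phi> x \<in> verts G" "\<phi> z = p (\<phi> x + axis i 1)" using fwd by blast+
      have "\<phi> x = p (p (\<phi> x + axis i 1) - axis i 1)" using id[OF b(1)] diff by simp
      also have "\<dots> = p (p (v + z) - axis i 1)" using b(2) IH by simp
      also have "\<dots> = p (v + x)" using a diff by (simp add: in_arcs_zgrid algebra_simps)
      finally show ?thesis .
    qed
  qed
  then show ?thesis using x by (auto simp: gball_def)
qed

lemma relpow_zgrid_shift: "(v + x, v + y) \<in> adj zgrid ^^ k \<longleftrightarrow> (x, y) \<in> adj zgrid ^^ k"
proof (induction k arbitrary: y)
  case 0
  then show ?case by simp
next
  case (Suc k)
  have "(v + x, v + y) \<in> adj zgrid ^^ Suc k \<longleftrightarrow>
      (\<exists>z. (v + x, v + z) \<in> adj zgrid ^^ k \<and> (v + z, v + y) \<in> adj zgrid)"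
    by (auto simp: relcomp_unfold) (metis add.commute diff_add_cancel)
  also have "\<dots> \<longleftrightarrow> (\<exists>z. (x, z) \<in> adj zgrid ^^ k \<and> (z, y) \<in> adj zgrid)"
    using Suc by (simp add: adj_def in_arcs_zgrid add.assoc)
  finally show ?case by (auto simp: relcomp_unfold)
qed

lemma ball_iso_zgrid: "ball_iso zgrid v r ((+) v)"
proof -
  have "gball zgrid v r = (+) v ` gball zgrid 0 r"
  proof (intro set_eqI iffI)
    fix w assume "w \<in> gball zgrid v r"
    then have "w - v \<in> gball zgrid 0 r"
      using relpow_zgrid_shift[of v 0 "w - v"] by (auto simp: gball_def zgrid_def)
    then show "w \<in> (+) v ` gball zgrid 0 r" by (intro image_eqI[of _ _ "w - v"]) auto
  next
    fix w assume "w \<in> (+) v ` gball zgrid 0 r"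
    then show "w \<in> gball zgrid v r"
      using relpow_zgrid_shift[of v 0] by (auto simp: gball_def zgrid_def)
  qed
  then show ?thesis
    by (auto simp: ball_iso_def bij_betw_def in_arcs_zgrid add.assoc)
qed

lemma nbhd_zgrid:
  fixes v :: "int ^ 'd::finite"
  shows "nbhd zgrid lab v r = (\<lambda>x \<in> gball zgrid 0 r. lab (v + x))"
proof -
  let ?\<phi> = "SOME \<phi>. ball_iso zgrid v r \<phi>"
  have "ball_iso zgrid v r ?\<phi>" by (rule someI[of "ball_iso zgrid v r", OF ball_iso_zgrid])
  then have "?\<phi> x = id (v + x)" if "x \<in> gball zgrid 0 r" for x
    by (rule ball_iso_unique) (use that in \<open>auto simp: in_arcs_zgrid, simp_all add: zgrid_def\<close>)
  then show ?thesis by (auto simp: nbhd_def fun_eq_iff)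
qed

lemma nbhd_torus:
  fixes v :: "int ^ 'd::finite"
  assumes "grid_like (torus m) v r" "v \<in> verts (torus m)"
  shows "nbhd (torus m) lab v r = (\<lambda>x \<in> gball zgrid 0 r. lab (reduce m (v + x)))"
proof -
  let ?\<phi> = "SOME \<phi>. ball_iso (torus m) v r \<phi>"
  have "ball_iso (torus m) v r ?\<phi>"
    using assms(1) unfolding grid_like_def by (rule someI_ex)
  then have "?\<phi> x = reduce m (v + x)" if "x \<in> gball zgrid 0 r" for x
    by (rule ball_iso_unique)
      (use that assms in \<open>auto simp: in_arcs_torus reduce_id reduce_add reduce_diff\<close>)
  then show ?thesis by (auto simp: nbhd_def fun_eq_iff)
qed

end

theory Submission
  imports Defs "HOL-Real_Asymp.Real_Asymp"
begin

text \<open>From uniform to deterministic algorithms: run the uniform algorithm with failure probability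
  \<open>\<epsilon> = 1 / 2 ^ 2 ^ n\<close>, which costs only \<open>O(log\<^sup>* n)\<close>, reading the random labels off the
  identifiers through a fixed function; the labelled balls are so few that some function is good
  for all of them.

  From deterministic to uniform algorithms: fix a large torus size \<open>n = s\<^sup>d\<close> and feed the algorithm
  for \<open>n\<close> with identifiers that are merely distinct within the distance it can see, that is, with
  a colouring of a power of the grid by at most \<open>n\<close> colours. Such a colouring is found as follows.
  Truncate the random labels at precisions that grow like a tower; the first precision at which the
  label of a vertex differs from those of its neighbours is its level, and level above \<open>i\<close> has
  probability of order \<open>1 / tower (i + 1)\<close>. Level \<open>i\<close> needs \<open>i\<close> rounds of bit-picking colour reduction
  to reach a constant number of colours, and a greedy colouring in order of level and reduced
  colour then takes \<open>O(i)\<close> further rounds.\<close>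

section \<open>Iterated logarithms and balls in grids and tori\<close>

text \<open>For the first direction, the number of labelled balls is \<open>n ^ k * card S\<close>
  raised to the size of a ball, which is polynomial in the radius. The double exponential leaves
  ample room above it, and two logarithms undo it. In the converse the obstacle is uniformity. At
  any fixed precision nearby labels collide with positive probability, so over the infinite grid no
  fixed number of rounds suffices, and a vertex must be able to stop although others need
  arbitrarily long. Ordering by level ensures this: a vertex waits only for vertices of smaller
  rank, so its own level bounds its radius. Reduction has to precede the greedy phase, since
  ordering by raw digits would need exponentially many rounds. Tower growth is a compromise. Fast
  growing precisions make high levels rare, but one reduction round only takes \<open>b\<close> bits
  to about \<open>card X * log b\<close> bits, so a precision can be at most exponential in the
  preceding one. Fixing \<open>n\<close> is possible because \<open>f n\<close> eventually falls far
  below the side of the torus; afterwards \<open>f n\<close> is a constant and only the colouring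
  has unbounded radius.\<close>

lemma log2_le: "log 2 x \<le> x - 1" if "2 \<le> x" for x :: real
proof -
  have "ln (x / 2) \<le> x / 2 - 1" using that by (intro ln_le_minus_one) auto
  moreover have "ln (2::real) \<ge> 1 / 2" using ln2_ge_two_thirds by linarith
  ultimately have "ln x - ln 2 \<le> (x - 2) / 2" using that by (simp add: ln_div field_simps)
  also have "\<dots> \<le> (x - 2) * ln 2" 
    using mult_left_mono[OF \<open>ln 2 \<ge> 1 / 2\<close>, of "x - 2"] that by simp
  finally have "ln x \<le> (x - 1) * ln 2" by (simp add: algebra_simps)
  then show ?thesis by (simp add: log_def divide_le_eq)
qed

text \<open>Above 2 a logarithm lowers the value by at least one (\<open>log2_le\<close>), and from
  between 1 and 2 it lands at or below 1. Hence the \<open>LEAST\<close> in \<open>log_star\<close>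
  is attained.\<close>

lemma iterated_log_le_1: "\<exists>k \<le> n. (log 2 ^^ k) x \<le> 1" if "x \<le> real n + 1" for x :: real
  using that
proof (induction n arbitrary: x)
  case 0
  then show ?case by simp
next
  case (Suc n)
  show ?case
  proof (cases "x \<le> 1")
    case True
    then show ?thesis by (intro exI[of _ 0]) auto
  next
    case False
    have "log 2 x \<le> real n + 1"
    proof (cases "x \<le> 2")
      case True
      then have "log 2 x \<le> 1" using False by (simp add: log_le_one_cancel_iff)
      then show ?thesis by simp
    next
      case False
      then show ?thesis using log2_le[of x] Suc.prems by simp
    qed
    then obtain k where "k \<le> n" "(log 2 ^^ k) (log 2 x) \<le> 1" using Suc.IH by blast
    then show ?thesis by (intro exI[of _ "Suc k"]) (simp add: funpow_swap1)
  qed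
qed

lemma log_star_spec: "(log 2 ^^ log_star x) x \<le> 1"
proof -
  have "\<exists>k. (log 2 ^^ k) x \<le> 1"
    using iterated_log_le_1[of x "nat \<lceil>x\<rceil>"] real_nat_ceiling_ge[of x]
    by (meson add_increasing2 zero_le_one)
  then show ?thesis unfolding log_star_def by (rule LeastI_ex)
qed

lemma log_star_le: "log_star x \<le> n" if "x \<le> real n + 1"
  using iterated_log_le_1[OF that] unfolding log_star_def
  by (meson Least_le le_trans)

lemma log_star_rec: "log_star x = Suc (log_star (log 2 x))" if "x > 1"
proof -
  have "log_star x = Suc (LEAST k. (log 2 ^^ Suc k) x \<le> 1)"
    unfolding log_star_def
    using log_star_spec[of x] by (rule Least_Suc) (use that in simp)
  then show ?thesis by (simp add: log_star_def funpow_swap1)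
qed

text \<open>Far from sharp, but after unfolding \<open>log_star_rec\<close> it bounds
  \<open>log_star\<close> by a logarithm or an iterated one, which is enough for all comparisons of
  growth.\<close>

lemma log_star_le_linear: "real (log_star x) \<le> x + 1" if "x \<ge> 0"
proof -
  have "x \<le> real (nat \<lceil>x\<rceil>) + 1" using that by linarith
  then have "log_star x \<le> nat \<lceil>x\<rceil>" by (rule log_star_le)
  then show ?thesis using that by linarith
qed

lemma log_star_ge_1: "1 \<le> log_star x" if "x > 1"
  using log_star_rec[OF that] by simp

text \<open>Inverse to \<open>log_star\<close> in the sense of \<open>le_tower_log_star\<close>,
  which is how \<open>\<epsilon>\<close> is finally compared with the precisions.\<close>

primrec tower :: "nat \<Rightarrow> nat" where
  "tower 0 = 1"
| "tower (Suc k) = 2 ^ tower k"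

lemma mono_tower: "mono tower"
  by (rule mono_iff_le_Suc[THEN iffD2]) (auto intro: less_imp_le less_exp)

lemma le_tower: "x \<le> real (tower k)" if "(log 2 ^^ k) x \<le> 1" for x :: real
  using that
proof (induction k arbitrary: x)
  case 0
  then show ?case by simp
next
  case (Suc k)
  then have *: "log 2 x \<le> real (tower k)" by (simp add: funpow_swap1)
  show ?case
  proof (cases "x > 0")
    case True
    then have "x = 2 powr (log 2 x)" by simp
    also have "\<dots> \<le> 2 powr (real (tower k))" using * by (intro powr_mono) auto
    finally show ?thesis by (simp add: powr_realpow)
  next
    \<comment> \<open>For nonpositive \<open>x\<close> the value of \<open>log 2 x\<close> says
      nothing, but a tower is nonnegative.\<close>
    case False
    then show ?thesis by (smt (verit) of_nat_0_le_iff)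
  qed
qed

lemma le_tower_log_star: "x \<le> real (tower (log_star x))"
  by (rule le_tower[OF log_star_spec])

section \<open>Balls of the grid and their size\<close>

lemma finite_box: "finite {x :: int ^ 'd::finite. \<forall>i. x $ i \<in> S i}" (is ?F)
    and card_box: "card {x :: int ^ 'd::finite. \<forall>i. x $ i \<in> S i} = (\<Prod>i\<in>UNIV. card (S i))" (is ?C)
  if "\<And>i. finite (S i)"
proof -
  have *: "bij_betw vec_lambda (PiE UNIV S) {x :: int ^ 'd::finite. \<forall>i. x $ i \<in> S i}"
    by (rule bij_betwI[where g = vec_nth]) auto
  have "finite (PiE UNIV S)" using that by (intro finite_PiE) auto
  then show ?F using bij_betw_finite[OF *] by simp
  show ?C using bij_betw_same_card[OF *] by (simp add: card_PiE)
qed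

lemma verts_zgrid [simp]: "verts zgrid = UNIV"
  by (simp add: zgrid_def)

lemma adj_zgrid: "(x, y) \<in> adj zgrid \<longleftrightarrow> (\<exists>i. y = x + axis i 1 \<or> x = y + axis i 1)"
  by (auto simp: adj_def in_arcs_zgrid)

lemma adj_zgrid_uminus: "(- x, - y) \<in> adj zgrid" if "(x, y) \<in> adj zgrid"
  using that by (fastforce simp: adj_zgrid)

lemma relpow_zgrid_uminus: "(- x, - y) \<in> adj zgrid ^^ k" if "(x, y) \<in> adj zgrid ^^ k"
  using that
proof (induction k arbitrary: y)
  case (Suc k)
  then obtain z where "(x, z) \<in> adj zgrid ^^ k" "(z, y) \<in> adj zgrid" by auto
  then show ?case using Suc.IH adj_zgrid_uminus by (meson relpow_Suc_I)
qed simp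

abbreviation zball :: "nat \<Rightarrow> (int ^ 'd::finite) set" where
  "zball r \<equiv> gball zgrid 0 r"

lemma mem_zball: "x \<in> zball r \<longleftrightarrow> (\<exists>k\<le>r. (0, x) \<in> adj zgrid ^^ k)"
  by (simp add: gball_def)

lemma zball_mono: "x \<in> zball r \<Longrightarrow> r \<le> s \<Longrightarrow> x \<in> zball s"
  unfolding mem_zball by (meson order_trans)

lemma zball_add: "x + y \<in> zball (r + s)" if x: "x \<in> zball r" and y: "y \<in> zball s"
proof -
  obtain k l where k: "k \<le> r" "(0, x) \<in> adj zgrid ^^ k" and l: "l \<le> s" "(0, y) \<in> adj zgrid ^^ l"
    using x y unfolding mem_zball by blast
  have "(x + 0, x + y) \<in> adj zgrid ^^ l" using l by (simp only: relpow_zgrid_shift)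
  then have "(0, x + y) \<in> adj zgrid ^^ (k + l)" using k by (auto simp: relpow_add)
  then show ?thesis using k l by (intro gball_zgrid_step[of _ "k + l"]) auto
qed

lemma zball_uminus: "- x \<in> zball r" if "x \<in> zball r"
  using that relpow_zgrid_uminus[of 0 x] by (auto simp: mem_zball)

lemma zball_diff: "x - y \<in> zball (r + s)" if "x \<in> zball r" "y \<in> zball s"
  using zball_add[OF that(1) zball_uminus[OF that(2)]] by simp

lemma relpow_zgrid_nth: "\<bar>x $ i\<bar> \<le> int k" if "(0, x) \<in> adj zgrid ^^ k"
  using that
proof (induction k arbitrary: x)
  case (Suc k)
  then obtain z where "(0, z) \<in> adj zgrid ^^ k" and z: "(z, x) \<in> adj zgrid" by auto
  then have "\<bar>z $ i\<bar> \<le> int k" using Suc.IH by blast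
  moreover have "\<bar>x $ i - z $ i\<bar> \<le> 1" using z by (auto simp: adj_zgrid axis_def)
  ultimately show ?case by simp
qed simp

lemma zball_nth: "\<bar>x $ i\<bar> \<le> int r" if "x \<in> zball r"
  using that relpow_zgrid_nth[of x _ i] unfolding mem_zball by (meson of_nat_mono order_trans)

lemma zball_subset_box: "zball r \<subseteq> {x. \<forall>i. x $ i \<in> {- int r..int r}}"
  using zball_nth by (auto simp: abs_le_iff minus_le_iff)

lemma finite_zball [simp]: "finite (zball r)"
  by (rule finite_subset[OF zball_subset_box finite_box]) auto

lemma card_zball_le: "card (zball r :: (int ^ 'd::finite) set) \<le> (2 * r + 1) ^ CARD('d)"
proof -
  have "card (zball r :: (int ^ 'd) set) \<le> card {x :: int ^ 'd. \<forall>i. x $ i \<in> {- int r..int r}}"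
    by (rule card_mono[OF finite_box zball_subset_box]) auto
  also have "\<dots> = (2 * r + 1) ^ CARD('d)"
    by (subst card_box) (auto simp: nat_add_distrib nat_mult_distrib)
  finally show ?thesis .
qed

text \<open>The points \<open>0, ..., r\<close> on one axis already lie in the ball. Through
  \<open>not_grid_like_large\<close> this excludes tori too small for the radius.\<close>

lemma card_zball_gt: "r < card (zball r :: (int ^ 'd::finite) set)"
proof -
  fix i :: 'd
  define p :: "nat \<Rightarrow> int ^ 'd" where "p j = axis i (int j)" for j
  have *: "(0, p j) \<in> adj zgrid ^^ j" for j
  proof (induction j)
    case 0
    then show ?case by (simp add: p_def vec_eq_iff axis_def)
  next
    case (Suc j)
    have "p (Suc j) = p j + axis i 1" by (simp add: p_def vec_eq_iff axis_def)
    then show ?case using Suc by (auto simp: relcomp_unfold adj_zgrid)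
  qed
  have "p ` {..r} \<subseteq> zball r" using gball_zgrid_step[OF *] by auto
  moreover have "inj_on p {..r}" by (auto simp: inj_on_def p_def vec_eq_iff axis_def)
  ultimately have "card {..r} \<le> card (zball r :: (int ^ 'd) set)" by (metis card_inj_on_le finite_zball)
  then show ?thesis by simp
qed

section \<open>The torus as a quotient of the grid\<close>

lemma verts_torus: "verts (torus m) = {x. \<forall>i. x $ i \<in> {0..<int (m i)}}"
  by (auto simp: torus_def Let_def)

lemma finite_verts_torus: "finite (verts (torus m))"
  unfolding verts_torus by (rule finite_box) auto

lemma card_verts_torus: "card (verts (torus m)) = (\<Prod>i\<in>UNIV. m i)"
  unfolding verts_torus by (subst card_box) auto

lemma reduce_in_verts: "(\<And>i. m i > 0) \<Longrightarrow> reduce m x \<in> verts (torus m)"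
  by (simp add: verts_torus reduce_def)

lemma reduce_eqD: "x = y" if "reduce m x = reduce m y" "\<And>i. \<bar>x $ i - y $ i\<bar> < int (m i)"
proof -
  have "x $ i = y $ i" for i
  proof -
    have "x $ i mod int (m i) = y $ i mod int (m i)"
      using that(1) by (auto simp: reduce_def vec_eq_iff)
    then have "int (m i) dvd x $ i - y $ i" by (simp add: mod_eq_dvd_iff)
    then have "x $ i - y $ i = 0"
      using that(2)[of i] dvd_imp_le_int[of "x $ i - y $ i" "int (m i)"] by linarith
    then show ?thesis by simp
  qed
  then show ?thesis by (simp add: vec_eq_iff)
qed

lemma adj_torus:
  assumes "\<And>i. m i > 0"
  shows "(v, w) \<in> adj (torus m) \<longleftrightarrow>
    v \<in> verts (torus m) \<and> (\<exists>x. w = reduce m (v + x) \<and> (0, x) \<in> adj zgrid)"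
proof (intro iffI conjI)
  assume "(v, w) \<in> adj (torus m)"
  then obtain i where "(v, w) \<in> arcs (torus m) i \<or> (w, v) \<in> arcs (torus m) i"
    by (auto simp: adj_def)
  then show "v \<in> verts (torus m)" "\<exists>x. w = reduce m (v + x) \<and> (0, x) \<in> adj zgrid"
  proof (atomize(full), elim disjE)
    assume "(v, w) \<in> arcs (torus m) i"
    then show "v \<in> verts (torus m) \<and> (\<exists>x. w = reduce m (v + x) \<and> (0, x) \<in> adj zgrid)"
      by (auto simp: in_arcs_torus adj_zgrid intro!: exI[of _ "axis i 1"])
  next
    assume a: "(w, v) \<in> arcs (torus m) i"
    then have "reduce m (v + - axis i 1) = w"
      by (simp add: in_arcs_torus reduce_add reduce_diff reduce_id)
    moreover have "(0, - axis i 1) \<in> adj zgrid" by (auto simp: adj_zgrid intro!: exI[of _ i])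
    moreover have "v \<in> verts (torus m)" using a assms by (auto simp: in_arcs_torus reduce_in_verts)
    ultimately show "v \<in> verts (torus m) \<and> (\<exists>x. w = reduce m (v + x) \<and> (0, x) \<in> adj zgrid)"
      by metis
  qed
next
  assume "v \<in> verts (torus m) \<and> (\<exists>x. w = reduce m (v + x) \<and> (0, x) \<in> adj zgrid)"
  then obtain x i where v: "v \<in> verts (torus m)" and w: "w = reduce m (v + x)"
    and x: "x = axis i 1 \<or> x = - axis i 1" by (auto simp: adj_zgrid eq_neg_iff_add_eq_0 add.commute)
  from x show "(v, w) \<in> adj (torus m)"
  proof
    assume "x = axis i 1"
    then show ?thesis using v w by (auto simp: adj_def in_arcs_torus)
  next
    assume "x = - axis i 1"
    then have "v = reduce m (w + axis i 1)" using v w by (simp add: reduce_add reduce_id)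
    moreover have "w \<in> verts (torus m)" using w assms by (simp add: reduce_in_verts)
    ultimately have "(w, v) \<in> arcs (torus m) i" by (simp add: in_arcs_torus)
    then show ?thesis by (auto simp: adj_def)
  qed
qed

text \<open>Walks lift along the covering \<open>reduce m\<close>, whatever the positive sides: the
  displacement \<open>x\<close> is followed in the grid and reduced at the end.\<close>

lemma relpow_torus:
  assumes m: "\<And>i. m i > 0" and v: "v \<in> verts (torus m)"
  shows "(v, w) \<in> adj (torus m) ^^ k \<longleftrightarrow> (\<exists>x. w = reduce m (v + x) \<and> (0, x) \<in> adj zgrid ^^ k)"
proof (induction k arbitrary: w)
  case 0
  then show ?case using v by (auto simp: reduce_id)
next
  case (Suc k)
  have shift: "(x, x + y) \<in> adj zgrid \<longleftrightarrow> (0, y) \<in> adj zgrid" for x y :: "int ^ 'a"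
    using relpow_zgrid_shift[of x 0 y 1] by simp
  show ?case
  proof
    assume "(v, w) \<in> adj (torus m) ^^ Suc k"
    then obtain z where "(v, z) \<in> adj (torus m) ^^ k" "(z, w) \<in> adj (torus m)" by auto
    then obtain x y where "(0, x) \<in> adj zgrid ^^ k" "z = reduce m (v + x)"
      "w = reduce m (z + y)" "(0, y) \<in> adj zgrid"
      using Suc.IH adj_torus[of m, OF m] by blast
    then have "w = reduce m (v + (x + y))" "(0, x + y) \<in> adj zgrid ^^ Suc k"
      using shift[of x y] by (auto simp: reduce_add add.assoc)
    then show "\<exists>x. w = reduce m (v + x) \<and> (0, x) \<in> adj zgrid ^^ Suc k" by blast
  next
    assume "\<exists>x. w = reduce m (v + x) \<and> (0, x) \<in> adj zgrid ^^ Suc k"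
    then obtain x z where w: "w = reduce m (v + x)" and z: "(0, z) \<in> adj zgrid ^^ k" "(z, x) \<in> adj zgrid"
      by auto
    have "(v, reduce m (v + z)) \<in> adj (torus m) ^^ k" using Suc.IH z by blast
    moreover have "(0, x - z) \<in> adj zgrid" using shift[of z "x - z"] z by simp
    then have "(reduce m (v + z), w) \<in> adj (torus m)"
      unfolding adj_torus[of m, OF m] using w m
      by (auto simp: reduce_in_verts reduce_add intro!: exI[of _ "x - z"])
    ultimately show "(v, w) \<in> adj (torus m) ^^ Suc k" by auto
  qed
qed

lemma gball_torus:
  assumes "\<And>i. m i > 0" "v \<in> verts (torus m)"
  shows "gball (torus m) v r = (\<lambda>x. reduce m (v + x)) ` zball r"
  using relpow_torus[of m, OF assms] reduce_in_verts[of m, OF assms(1)] by (fastforce simp: gball_def)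

text \<open>Points of the ball differ by at most \<open>2 * r\<close> in a coordinate, and comparing
  \<open>y\<close> with the successor \<open>x + axis i 1\<close> adds one. Longer sides therefore
  create neither coincidences nor extra arcs.\<close>

lemma ball_iso_torus:
  assumes m: "\<And>i. 2 * r + 1 < m i" and v: "v \<in> verts (torus m)"
  shows "ball_iso (torus m) v r (\<lambda>x. reduce m (v + x))"
proof -
  have m0: "\<And>i. m i > 0" using m by (metis gr_zeroI not_less_zero)
  have *: "x = y" if "reduce m (v + x) = reduce m (v + y)" "\<And>i. \<bar>x $ i - y $ i\<bar> \<le> 2 * int r + 1" for x y
  proof -
    have "v + x = v + y"
    proof (rule reduce_eqD[OF that(1)])
      fix i
      have "\<bar>x $ i - y $ i\<bar> < int (m i)" using that(2)[of i] m[of i] by linarith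
      then show "\<bar>(v + x) $ i - (v + y) $ i\<bar> < int (m i)" by simp
    qed
    then show ?thesis by simp
  qed
  have diff: "\<bar>x $ i - y $ i\<bar> \<le> 2 * int r" if "x \<in> zball r" "y \<in> zball r" for x y :: "int ^ 'a" and i
    using zball_nth[OF that(1), of i] zball_nth[OF that(2), of i] by linarith
  have "inj_on (\<lambda>x. reduce m (v + x)) (zball r)"
    by (rule inj_onI, rule *) (auto intro: order_trans[OF diff])
  moreover have "(x, y) \<in> arcs zgrid i \<longleftrightarrow> (reduce m (v + x), reduce m (v + y)) \<in> arcs (torus m) i"
    if "x \<in> zball r" "y \<in> zball r" for x y i
  proof
    assume "(x, y) \<in> arcs zgrid i"
    then show "(reduce m (v + x), reduce m (v + y)) \<in> arcs (torus m) i"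
      using m0 by (simp add: in_arcs_zgrid in_arcs_torus reduce_in_verts reduce_add add.assoc)
  next
    assume "(reduce m (v + x), reduce m (v + y)) \<in> arcs (torus m) i"
    then have "reduce m (v + y) = reduce m (v + (x + axis i 1))"
      by (simp add: in_arcs_torus reduce_add add.assoc)
    moreover have "\<bar>y $ j - (x + axis i 1) $ j\<bar> \<le> 2 * int r + 1" for j
      using diff[OF that(2,1), of j] by (auto simp: axis_def)
    ultimately show "(x, y) \<in> arcs zgrid i" using * by (simp add: in_arcs_zgrid)
  qed
  ultimately show ?thesis
    unfolding ball_iso_def bij_betw_def by (auto simp: gball_torus[of m, OF m0 v] reduce_id[OF v])
qed

text \<open>The isomorphism is unique, so it must be reduction. Identifiers that are unique on the
  torus thus stay unique when pulled back to \<open>zball r\<close>.\<close>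

lemma inj_on_zball_torus:
  assumes "grid_like (torus m) v r" "v \<in> verts (torus m)"
  shows "inj_on (\<lambda>x. reduce m (v + x)) (zball r)"
proof -
  obtain \<phi> where \<phi>: "ball_iso (torus m) v r \<phi>" using assms unfolding grid_like_def by blast
  have "\<phi> x = reduce m (v + x)" if "x \<in> zball r" for x
    by (rule ball_iso_unique[OF \<phi> assms(2)])
      (use that in \<open>auto simp: in_arcs_torus reduce_id reduce_add reduce_diff\<close>)
  moreover have "inj_on \<phi> (zball r)" using \<phi> by (simp add: ball_iso_def bij_betw_def)
  ultimately show ?thesis by (simp add: inj_on_def)
qed

lemma not_grid_like_large:
  assumes "finite (verts G)" "card (verts G) \<le> r"
  shows "\<not> grid_like (G :: ('d::finite, 'v) lgraph) v r"
proof
  assume "grid_like G v r"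
  then obtain \<phi> where "bij_betw \<phi> (zball r :: (int ^ 'd) set) (gball G v r)"
    by (auto simp: grid_like_def ball_iso_def)
  then have "card (zball r :: (int ^ 'd) set) = card (gball G v r)" by (rule bij_betw_same_card)
  also have "\<dots> \<le> card (verts G)" by (intro card_mono assms) (auto simp: gball_def)
  finally show False using card_zball_gt[of r, where 'd = 'd] assms by simp
qed


section \<open>Random labellings\<close>

lemma space_unif01 [simp]: "space unif01 = {0..1}"
  by (simp add: unif01_def space_restrict_space)

lemma measurable_unif01_borel: "(\<lambda>x. x) \<in> unif01 \<rightarrow>\<^sub>M borel"
  unfolding unif01_def by (rule measurable_restrict_space1) simp

lemma emeasure_unif01: "A \<in> sets unif01 \<Longrightarrow> emeasure unif01 A = emeasure lborel A"
  unfolding unif01_def by (subst emeasure_restrict_space) (auto simp: sets_restrict_space_iff)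

lemma prob_space_unif01: "prob_space unif01"
proof
  have "emeasure unif01 (space unif01) = emeasure lborel {0..1::real}"
    using emeasure_unif01[OF sets.top[of unif01]] by simp
  then show "emeasure unif01 (space unif01) = 1" by simp
qed

interpretation unif01: prob_space unif01
  by (rule prob_space_unif01)

interpretation iid: product_prob_space "\<lambda>_ :: int ^ 'd::finite. unif01" UNIV
  by unfold_locales

lemma iid_PiM: "iid = PiM UNIV (\<lambda>_. unif01)"
  by (simp add: iid_def)

lemma space_iid: "space iid = {u. \<forall>v. u v \<in> {0..1}}"
  by (auto simp: iid_PiM space_PiM)

lemma prob_space_iid: "prob_space iid"
  unfolding iid_PiM by (rule prob_space_PiM) (rule prob_space_unif01)

lemma measurable_reindex:
  "(\<lambda>w v. w (p v)) \<in> PiM UNIV (\<lambda>_. unif01) \<rightarrow>\<^sub>M (iid :: (int ^ 'd::finite \<Rightarrow> real) measure)"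
  unfolding iid_PiM by (rule measurable_PiM_single') (auto simp: space_PiM)

lemma distr_reindex:
  fixes p :: "int ^ 'd::finite \<Rightarrow> 'j"
  assumes "inj p"
  shows "distr (PiM UNIV (\<lambda>_. unif01)) iid (\<lambda>w v. w (p v)) = iid"
  using distr_PiM_reindex[of UNIV "\<lambda>_. unif01" p UNIV] assms prob_space_unif01
  by (simp add: iid_PiM restrict_UNIV)

text \<open>Independent labels stay independent when pulled back along an injection. The index type
  of the source is free because \<open>p\<close> is a translation in one use and sends vertices to
  identifiers in another.\<close>

lemma emeasure_reindex:
  fixes p :: "int ^ 'd::finite \<Rightarrow> 'j"
  assumes "inj p" "E \<in> sets iid"
  shows "emeasure (PiM UNIV (\<lambda>_. unif01)) {w \<in> space (PiM UNIV (\<lambda>_. unif01)). (\<lambda>v. w (p v)) \<in> E}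
    = emeasure iid E"
proof -
  have "emeasure iid E = emeasure (distr (PiM UNIV (\<lambda>_. unif01)) iid (\<lambda>w v. w (p v))) E"
    using distr_reindex[OF assms(1)] by simp
  also have "\<dots> = emeasure (PiM UNIV (\<lambda>_. unif01))
      ((\<lambda>w v. w (p v)) -` E \<inter> space (PiM UNIV (\<lambda>_. unif01)))"
    by (rule emeasure_distr[OF measurable_reindex assms(2)])
  finally show ?thesis by (simp add: vimage_def Int_def conj_commute)
qed

lemma measurable_iid_nbhd:
  assumes "\<sigma> \<in> UNIV \<rightarrow> S"
  shows "(\<lambda>u. nbhd zgrid (\<lambda>v. (\<sigma> v, u v)) w r) \<in> iid \<rightarrow>\<^sub>M nbhd_space S r"
  unfolding nbhd_zgrid nbhd_space_def
proof (rule measurable_restrict)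
  fix x :: "int ^ 'a" assume "x \<in> zball r"
  have "(\<lambda>u. u (w + x)) \<in> iid \<rightarrow>\<^sub>M unif01"
    unfolding iid_PiM by (rule measurable_component_singleton) simp
  moreover have "(\<lambda>u. \<sigma> (w + x)) \<in> iid \<rightarrow>\<^sub>M count_space S"
    using assms by (intro measurable_const) auto
  ultimately show "(\<lambda>u. (\<sigma> (w + x), u (w + x))) \<in> iid \<rightarrow>\<^sub>M count_space S \<Otimes>\<^sub>M unif01" by measurable
qed

lemma coding_radius_gt_iff:
  "enat r < coding_radius A \<omega> v \<longleftrightarrow> (\<forall>s\<le>r. nbhd zgrid \<omega> v s \<notin> stops A s)"
proof
  assume "enat r < coding_radius A \<omega> v"
  then show "\<forall>s\<le>r. nbhd zgrid \<omega> v s \<notin> stops A s"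
    unfolding coding_radius_def by (auto simp: less_INF_D dest!: less_INF_D)
next
  assume *: "\<forall>s\<le>r. nbhd zgrid \<omega> v s \<notin> stops A s"
  have "enat (Suc r) \<le> coding_radius A \<omega> v"
    unfolding coding_radius_def by (rule INF_greatest) (use * not_less_eq_eq in auto)
  then show "enat r < coding_radius A \<omega> v" by (meson enat_ord_simps(2) lessI less_le_trans)
qed

lemma coding_radius_eq:
  assumes "nbhd zgrid \<omega> v r \<in> stops A r" "\<And>s. s < r \<Longrightarrow> nbhd zgrid \<omega> v s \<notin> stops A s"
  shows "coding_radius A \<omega> v = enat r"
proof (rule antisym)
  show "coding_radius A \<omega> v \<le> enat r"
    unfolding coding_radius_def by (rule INF_lower) (use assms in auto)
  show "enat r \<le> coding_radius A \<omega> v"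
    unfolding coding_radius_def by (rule INF_greatest) (use assms not_less in auto)
qed

lemma uoutput_eq:
  assumes "\<exists>r. nbhd zgrid \<omega> v r \<in> stops A r"
  defines "r \<equiv> LEAST r. nbhd zgrid \<omega> v r \<in> stops A r"
  shows "uoutput A \<omega> v = rule A r (nbhd zgrid \<omega> v r)" "coding_radius A \<omega> v = enat r"
proof -
  show "coding_radius A \<omega> v = enat r"
  proof (rule coding_radius_eq)
    show "nbhd zgrid \<omega> v r \<in> stops A r" unfolding r_def by (rule LeastI_ex[OF assms(1)])
    show "\<And>s. s < r \<Longrightarrow> nbhd zgrid \<omega> v s \<notin> stops A s" unfolding r_def by (rule not_less_Least)
  qed
  then show "uoutput A \<omega> v = rule A r (nbhd zgrid \<omega> v r)" by (simp add: uoutput_def)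
qed

lemma sets_coding_radius_gt:
  fixes A :: "('d::finite, 'i, 'o) ualg"
  assumes "\<And>r. stops A r \<in> sets (nbhd_space S r)" "\<sigma> \<in> UNIV \<rightarrow> S"
  shows "{u \<in> space iid. enat r < coding_radius A (\<lambda>v. (\<sigma> v, u v)) w} \<in> sets iid"
proof -
  have "{u \<in> space iid. nbhd zgrid (\<lambda>v. (\<sigma> v, u v)) w s \<in> stops A s} \<in> sets iid" for s
    using measurable_sets[OF measurable_iid_nbhd[OF assms(2)] assms(1)]
    by (simp add: vimage_def Int_def conj_commute)
  then have "space iid - {u \<in> space iid. nbhd zgrid (\<lambda>v. (\<sigma> v, u v)) w s \<in> stops A s} \<in> sets iid" for s
    by (rule sets.compl_sets)
  then have "(\<Inter>s\<in>{..r}. space iid - {u \<in> space iid. nbhd zgrid (\<lambda>v. (\<sigma> v, u v)) w s \<in> stops A s}) \<in> sets iid"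
    by (intro sets.finite_INT) auto
  also have "(\<Inter>s\<in>{..r}. space iid - {u \<in> space iid. nbhd zgrid (\<lambda>v. (\<sigma> v, u v)) w s \<in> stops A s})
      = {u \<in> space iid. enat r < coding_radius A (\<lambda>v. (\<sigma> v, u v)) w}"
    by (auto simp: coding_radius_gt_iff)
  finally show ?thesis .
qed

section \<open>Truncated labels and their collisions\<close>

definition digits :: "nat \<Rightarrow> real \<Rightarrow> nat" where
  "digits a x = nat \<lfloor>x * 2 ^ a\<rfloor>"

text \<open>The bound is attained: the label 1 gives \<open>2 ^ a\<close>. The
  \<open>2 ^ a + 1\<close> values take \<open>a + 1\<close> bits, which explains the later
  \<open>a i + 1\<close>.\<close>

lemma digits_le: "digits a x \<le> 2 ^ a" if "x \<in> {0..1}"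
proof -
  have "x * 2 ^ a \<le> 2 ^ a" using that by (simp add: mult_left_le_one_le)
  then have "\<lfloor>x * 2 ^ a\<rfloor> \<le> \<lfloor>2 ^ a :: real\<rfloor>" by (rule floor_mono)
  also have "\<lfloor>2 ^ a :: real\<rfloor> = 2 ^ a" using floor_of_int[of "2 ^ a", where 'a = real] by simp
  finally show ?thesis by (simp add: digits_def nat_le_iff)
qed

text \<open>Coarse digits are a function of fine ones, so agreement at one precision implies
  agreement at every smaller one.\<close>

lemma digits_div: "digits b x = digits a x div 2 ^ (a - b)" if "b \<le> a"
proof -
  have "\<lfloor>x * 2 ^ a / real_of_int (2 ^ (a - b))\<rfloor> = \<lfloor>x * 2 ^ a\<rfloor> div 2 ^ (a - b)"
    using floor_divide_real_eq_div[of "2 ^ (a - b)" "x * 2 ^ a"] by simp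
  moreover have "x * 2 ^ a / real_of_int (2 ^ (a - b)) = x * 2 ^ b"
  proof -
    have "(2::real) ^ a = 2 ^ (a - b) * 2 ^ b" using that by (simp add: power_add[symmetric])
    then show ?thesis by simp
  qed
  ultimately show ?thesis by (simp add: digits_def nat_div_distrib' nat_power_eq)
qed

lemma measurable_digits: "digits a \<in> unif01 \<rightarrow>\<^sub>M count_space UNIV"
proof -
  have "(\<lambda>x::real. x * 2 ^ a) \<in> borel \<rightarrow>\<^sub>M borel"
    by (intro borel_measurable_times measurable_ident_sets measurable_const) auto
  then have "(\<lambda>x::real. \<lfloor>x * 2 ^ a\<rfloor>) \<in> borel \<rightarrow>\<^sub>M count_space UNIV"
    by (rule measurable_compose[OF _ measurable_real_floor])
  from measurable_compose[OF this, of nat "count_space UNIV"]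
  have "(\<lambda>x::real. nat \<lfloor>x * 2 ^ a\<rfloor>) \<in> borel \<rightarrow>\<^sub>M count_space UNIV"
    by simp
  moreover have "digits a = (\<lambda>x. nat \<lfloor>x * 2 ^ a\<rfloor>)" by (rule ext) (rule digits_def)
  ultimately have "digits a \<in> borel \<rightarrow>\<^sub>M count_space UNIV" by (simp only:)
  from measurable_compose[OF measurable_unif01_borel this]
  show ?thesis .
qed

lemma sets_digits: "{x \<in> {0..1}. digits a x = j} \<in> sets unif01"
  using measurable_sets[OF measurable_digits, of "{j}" a] by (simp add: vimage_def Int_def conj_commute)

lemma emeasure_digits_le: "emeasure unif01 {x \<in> {0..1}. digits a x = j} \<le> ennreal (1 / 2 ^ a)"
proof -
  have "{x \<in> {0..1}. digits a x = j} \<subseteq> {real j / 2 ^ a .. (real j + 1) / 2 ^ a}"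
  proof
    fix x :: real assume x: "x \<in> {x \<in> {0..1}. digits a x = j}"
    then have "0 \<le> \<lfloor>x * 2 ^ a\<rfloor>" by simp
    then have "real j = real_of_int \<lfloor>x * 2 ^ a\<rfloor>" using x by (auto simp: digits_def)
    then have "real j \<le> x * 2 ^ a" "x * 2 ^ a \<le> real j + 1" by linarith+
    then show "x \<in> {real j / 2 ^ a .. (real j + 1) / 2 ^ a}" by (simp add: field_simps)
  qed
  then have "emeasure lborel {x \<in> {0..1}. digits a x = j}
      \<le> emeasure lborel {real j / 2 ^ a .. (real j + 1) / 2 ^ a}"
    by (intro emeasure_mono) auto
  also have "\<dots> = ennreal (1 / 2 ^ a)"
    by (subst emeasure_lborel_Icc) (auto simp: divide_right_mono diff_divide_distrib[symmetric])
  finally show ?thesis using emeasure_unif01[OF sets_digits] by simp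
qed

text \<open>The event is covered by \<open>2 ^ a + 1\<close> cells, into each of which both
  independent labels fall with probability at most \<open>1 / 4 ^ a\<close>. The factor 2 absorbs
  the additional cell.\<close>

lemma emeasure_digits_collision:
  fixes v w :: "int ^ 'd::finite"
  assumes "v \<noteq> w"
  shows "emeasure iid {u \<in> space iid. digits a (u v) = digits a (u w)} \<le> ennreal (2 / 2 ^ a)"
proof -
  define I where "I j = {x \<in> {0..1}. digits a x = j}" for j
  define E where "E j = iid.emb UNIV {v, w} (PiE {v, w} (\<lambda>_. I j))" for j
  have I: "I j \<in> sets unif01" for j unfolding I_def by (rule sets_digits)
  have E: "E j \<in> sets iid" for j
    unfolding E_def iid_PiM by (intro measurable_prod_emb sets_PiM_I_finite) (auto simp: I)
  have "emeasure iid (E j) = (\<Prod>i\<in>{v, w}. emeasure unif01 (I j))" for j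
    unfolding E_def iid_PiM by (rule iid.emeasure_PiM_emb) (auto simp: I)
  also have "(\<Prod>i\<in>{v, w}. emeasure unif01 (I j)) = emeasure unif01 (I j) * emeasure unif01 (I j)" for j
    using assms by simp
  also have "\<dots> j \<le> ennreal (1 / 2 ^ a) * ennreal (1 / 2 ^ a)" for j
    unfolding I_def by (intro mult_mono emeasure_digits_le) auto
  finally have le: "emeasure iid (E j) \<le> ennreal (1 / 2 ^ a * (1 / 2 ^ a))" for j
    by (simp add: ennreal_mult[symmetric])
  have "{u \<in> space iid. digits a (u v) = digits a (u w)} \<subseteq> (\<Union>j\<in>{..2 ^ a}. E j)"
  proof
    fix u assume u: "u \<in> {u \<in> space iid. digits a (u v) = digits a (u w)}"
    then have "u v \<in> {0..1}" "u w \<in> {0..1}" unfolding space_iid by blast+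
    then have "u \<in> E (digits a (u v))"
      using u by (auto simp: E_def I_def prod_emb_def space_iid)
    then show "u \<in> (\<Union>j\<in>{..2 ^ a}. E j)" using digits_le[OF \<open>u v \<in> {0..1}\<close>] by auto
  qed
  then have "emeasure iid {u \<in> space iid. digits a (u v) = digits a (u w)} \<le> emeasure iid (\<Union>j\<in>{..2 ^ a}. E j)"
    using E by (intro emeasure_mono) auto
  also have "\<dots> \<le> (\<Sum>j\<in>{..2 ^ a}. emeasure iid (E j))"
    using E by (intro emeasure_subadditive_finite) auto
  also have "\<dots> \<le> (\<Sum>j\<in>{..(2::nat) ^ a}. ennreal (1 / 2 ^ a * (1 / 2 ^ a)))"
    by (intro sum_mono le)
  also have "\<dots> = ennreal ((2 ^ a + 1) * (1 / 2 ^ a * (1 / 2 ^ a)))"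
    by (subst sum_ennreal) auto
  also have "\<dots> \<le> ennreal (2 / 2 ^ a)"
    by (intro ennreal_leI) (simp add: field_simps)
  finally show ?thesis .
qed

lemma measurable_iid_component: "(\<lambda>u. u v) \<in> iid \<rightarrow>\<^sub>M unif01"
  unfolding iid_PiM by (rule measurable_component_singleton) simp

lemma sets_digits_collision: "{u \<in> space iid. digits a (u v) = digits a (u w)} \<in> sets iid"
  using measurable_compose[OF measurable_iid_component measurable_digits] by measurable

text \<open>\<open>P\<close> can be arbitrary: inputs and truncated labels on a ball take finitely
  many values, each fibre is a finite intersection of measurable conditions on coordinates, and the
  event is a finite union of fibres.\<close>

lemma sets_nbhd_space_digits:
  fixes P :: "(int ^ 'd::finite \<Rightarrow> 'i) \<Rightarrow> (int ^ 'd \<Rightarrow> nat) \<Rightarrow> bool"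
  assumes "finite S"
  shows "{\<eta> \<in> space (nbhd_space S r). P (\<lambda>x\<in>zball r. fst (\<eta> x)) (\<lambda>x\<in>zball r. digits a (snd (\<eta> x)))}
    \<in> sets (nbhd_space S r)"
proof -
  let ?M = "nbhd_space S r :: (int ^ 'd \<Rightarrow> 'i \<times> real) measure"
  let ?F = "\<lambda>\<eta>. (\<lambda>x\<in>zball r. fst (\<eta> x :: 'i \<times> real), \<lambda>x\<in>zball r. digits a (snd (\<eta> x)))"
  define W where "W = ((zball r \<rightarrow>\<^sub>E S) :: (int ^ 'd \<Rightarrow> 'i) set) \<times> (zball r \<rightarrow>\<^sub>E {..(2::nat) ^ a} :: (int ^ 'd \<Rightarrow> nat) set)"
  have "finite W" unfolding W_def using assms by (intro finite_cartesian_product finite_PiE) auto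
  have spc: "\<eta> x \<in> S \<times> {0..1}" if "\<eta> \<in> space ?M" "x \<in> zball r" for \<eta> x
    using that by (auto simp: nbhd_space_def space_PiM space_pair_measure PiE_def Pi_def)
  have W: "?F \<eta> \<in> W" if "\<eta> \<in> space ?M" for \<eta>
  proof -
    have "fst (\<eta> x) \<in> S" "digits a (snd (\<eta> x)) \<le> 2 ^ a" if "x \<in> zball r" for x
      using spc[OF \<open>\<eta> \<in> space ?M\<close> that] digits_le[of "snd (\<eta> x)" a] by (auto simp: mem_Times_iff)
    then show ?thesis by (simp add: W_def restrict_PiE_iff)
  qed
  have single: "{\<eta> \<in> space ?M. ?F \<eta> = y} \<in> sets ?M" if "y \<in> W" for y
  proof -
    have comp: "(\<lambda>\<eta>. \<eta> x) \<in> ?M \<rightarrow>\<^sub>M count_space S \<Otimes>\<^sub>M unif01" if "x \<in> zball r" for x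
      unfolding nbhd_space_def by (rule measurable_component_singleton[OF that])
    have "{\<eta> \<in> space ?M. fst (\<eta> x) = fst y x \<and> digits a (snd (\<eta> x)) = snd y x} \<in> sets ?M"
      if "x \<in> zball r" for x
    proof -
      have 1: "(\<lambda>\<eta>. fst (\<eta> x)) \<in> ?M \<rightarrow>\<^sub>M count_space S"
        using measurable_compose[OF comp[OF that] measurable_fst] .
      have 2: "(\<lambda>\<eta>. digits a (snd (\<eta> x))) \<in> ?M \<rightarrow>\<^sub>M count_space UNIV"
        using measurable_compose[OF measurable_compose[OF comp[OF that] measurable_snd] measurable_digits] .
      have "fst y x \<in> S" using \<open>y \<in> W\<close> that by (auto simp: W_def)
      then have "{\<eta> \<in> space ?M. fst (\<eta> x) = fst y x} \<in> sets ?M"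
        using measurable_sets[OF 1, of "{fst y x}"] by (simp add: vimage_def Int_def conj_commute)
      moreover have "{\<eta> \<in> space ?M. digits a (snd (\<eta> x)) = snd y x} \<in> sets ?M"
        using measurable_sets[OF 2, of "{snd y x}"] by (simp add: vimage_def Int_def conj_commute)
      ultimately show ?thesis by (intro sets.sets_Collect_conj)
    qed
    then have "{\<eta> \<in> space ?M. \<forall>x\<in>zball r. fst (\<eta> x) = fst y x \<and> digits a (snd (\<eta> x)) = snd y x} \<in> sets ?M"
      by (intro sets.sets_Collect_finite_All) auto
    moreover have "?F \<eta> = y \<longleftrightarrow> (\<forall>x\<in>zball r. fst (\<eta> x) = fst y x \<and> digits a (snd (\<eta> x)) = snd y x)" for \<eta>
    proof -
      have ext: "restrict h (zball r) = f \<longleftrightarrow> (\<forall>x\<in>zball r. h x = f x)" if "f \<in> zball r \<rightarrow>\<^sub>E T"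
        for h f :: "int ^ 'd \<Rightarrow> 'b" and T
      proof
        assume *: "\<forall>x\<in>zball r. h x = f x"
        show "restrict h (zball r) = f"
        proof
          fix x show "restrict h (zball r) x = f x"
            using * PiE_arb[OF that, of x] by (cases "x \<in> zball r") auto
        qed
      qed auto
      have "fst y \<in> zball r \<rightarrow>\<^sub>E S" "snd y \<in> zball r \<rightarrow>\<^sub>E {..2 ^ a}"
        using \<open>y \<in> W\<close> by (auto simp: W_def)
      then show ?thesis by (simp add: prod_eq_iff ext ball_conj_distrib)
    qed
    ultimately show ?thesis by simp
  qed
  have "(\<Union>y\<in>{y \<in> W. P (fst y) (snd y)}. {\<eta> \<in> space ?M. ?F \<eta> = y}) \<in> sets ?M"
    using \<open>finite W\<close> single by (intro sets.finite_UN) auto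
  also have "(\<Union>y\<in>{y \<in> W. P (fst y) (snd y)}. {\<eta> \<in> space ?M. ?F \<eta> = y})
      = {\<eta> \<in> space ?M. P (fst (?F \<eta>)) (snd (?F \<eta>))}"
    using W by blast
  finally show ?thesis by simp
qed


section \<open>From uniform to deterministic algorithms\<close>

text \<open>Cutting the exploration off at radius \<open>R\<close> leaves a function of a single
  ball. \<open>o0\<close> stands in where nothing has stopped by then; the seed in
  \<open>exists_seed\<close> is selected to avoid that case.\<close>

definition truncated_output ::
  "('d::finite, 'i, 'o) ualg \<Rightarrow> 'o \<Rightarrow> nat \<Rightarrow> (int ^ 'd \<Rightarrow> 'i \<times> real) \<Rightarrow> 'o" where
  "truncated_output A o0 R \<eta> =
     (if \<exists>r\<le>R. restrict \<eta> (zball r) \<in> stops A r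
      then let r = LEAST r. r \<le> R \<and> restrict \<eta> (zball r) \<in> stops A r in rule A r (restrict \<eta> (zball r))
      else o0)"

lemma truncated_output_eq:
  assumes "\<not> enat R < coding_radius A \<omega> v" "\<And>y. y \<in> zball R \<Longrightarrow> \<eta> y = \<omega> (v + y)"
  shows "truncated_output A o0 R \<eta> = uoutput A \<omega> v"
proof -
  have eq: "restrict \<eta> (zball r) = nbhd zgrid \<omega> v r" if "r \<le> R" for r
    using assms(2) zball_mono[OF _ that] by (auto simp: nbhd_zgrid fun_eq_iff)
  obtain r where r: "r \<le> R" "nbhd zgrid \<omega> v r \<in> stops A r"
    using assms(1) unfolding coding_radius_gt_iff by blast
  define r0 where "r0 = (LEAST r. nbhd zgrid \<omega> v r \<in> stops A r)"
  have r0: "nbhd zgrid \<omega> v r0 \<in> stops A r0" unfolding r0_def by (rule LeastI[of _ r]) (rule r)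
  have "r0 \<le> r" unfolding r0_def by (rule Least_le) (rule r)
  then have r0R: "r0 \<le> R" using r by simp
  have "(LEAST r. r \<le> R \<and> restrict \<eta> (zball r) \<in> stops A r) = r0"
  proof (rule Least_equality)
    show "r0 \<le> R \<and> restrict \<eta> (zball r0) \<in> stops A r0" using r0 r0R eq[OF r0R] by simp
    show "r0 \<le> s" if "s \<le> R \<and> restrict \<eta> (zball s) \<in> stops A s" for s
    proof (rule ccontr)
      assume "\<not> r0 \<le> s"
      then have "s < r0" by simp
      moreover from this have "nbhd zgrid \<omega> v s \<in> stops A s" using that eq[of s] r0R by simp
      ultimately show False unfolding r0_def using not_less_Least by blast
    qed
  qed
  moreover have "\<exists>r\<le>R. restrict \<eta> (zball r) \<in> stops A r" using r eq by metis
  moreover have "uoutput A \<omega> v = rule A r0 (nbhd zgrid \<omega> v r0)"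
    unfolding r0_def by (rule uoutput_eq) (use r in blast)
  ultimately show ?thesis using eq[OF r0R] by (simp add: truncated_output_def)
qed

lemma truncated_output_cong:
  assumes "\<And>y. y \<in> zball R \<Longrightarrow> \<eta> y = \<zeta> y"
  shows "truncated_output A o0 R \<eta> = truncated_output A o0 R \<zeta>"
proof -
  have eq: "restrict \<eta> (zball r) = restrict \<zeta> (zball r)" if "r \<le> R" for r
    using assms zball_mono[OF _ that] by (intro restrict_ext) auto
  then have iff: "r \<le> R \<and> restrict \<eta> (zball r) \<in> stops A r \<longleftrightarrow> r \<le> R \<and> restrict \<zeta> (zball r) \<in> stops A r" for r
    by auto
  define r where "r = (LEAST r. r \<le> R \<and> restrict \<zeta> (zball r) \<in> stops A r)"
  show ?thesis
  proof (cases "\<exists>r\<le>R. restrict \<zeta> (zball r) \<in> stops A r")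
    case True
    then have "r \<le> R" unfolding r_def by (metis (mono_tags, lifting) LeastI_ex)
    then show ?thesis using eq[of r] unfolding truncated_output_def iff r_def by (auto simp: Let_def)
  next
    case False
    then show ?thesis unfolding truncated_output_def iff by auto
  qed
qed

lemma truncated_output_in:
  assumes "is_ualg S T A" "o0 \<in> T"
  shows "truncated_output A o0 R \<eta> \<in> T"
proof (cases "\<exists>r\<le>R. restrict \<eta> (zball r) \<in> stops A r")
  case True
  define r where "r = (LEAST r. r \<le> R \<and> restrict \<eta> (zball r) \<in> stops A r)"
  have r: "restrict \<eta> (zball r) \<in> stops A r"
    unfolding r_def using True by (metis (mono_tags, lifting) LeastI_ex)
  have "stops A r \<subseteq> space (nbhd_space S r)"
    using assms(1) sets.sets_into_space unfolding is_ualg_def by blast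
  then have "restrict \<eta> (zball r) \<in> space (restrict_space (nbhd_space S r) (stops A r))"
    using r by (auto simp: space_restrict_space)
  moreover have "rule A r \<in> restrict_space (nbhd_space S r) (stops A r) \<rightarrow>\<^sub>M count_space T"
    using assms(1) by (simp add: is_ualg_def)
  ultimately have "rule A r (restrict \<eta> (zball r)) \<in> T" by (auto dest: measurable_space)
  then show ?thesis using True by (simp add: truncated_output_def r_def[symmetric] Let_def)
qed (use assms in \<open>auto simp: truncated_output_def\<close>)

text \<open>\<open>prob_beyond\<close> speaks of the origin only. Translating to \<open>w\<close>
  shifts the input, which the supremum over inputs absorbs, and the random labels, whose
  distribution is invariant.\<close>

lemma emeasure_coding_radius_le:
  fixes A :: "('d::finite, 'i, 'o) ualg"
  assumes A: "is_ualg S T A" and \<sigma>: "\<sigma> \<in> UNIV \<rightarrow> S"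
  shows "emeasure iid {u \<in> space iid. enat r < coding_radius A (\<lambda>v. (\<sigma> v, u v)) w} \<le> prob_beyond S A r"
proof -
  define E where "E = {u \<in> space iid. enat r < coding_radius A (\<lambda>v. (\<sigma> (w + v), u v)) 0}"
  have E: "E \<in> sets iid"
    unfolding E_def by (rule sets_coding_radius_gt[where S = S]) (use A \<sigma> in \<open>auto simp: is_ualg_def\<close>)
  have "enat r < coding_radius A (\<lambda>v. (\<sigma> v, u v)) w
      \<longleftrightarrow> enat r < coding_radius A (\<lambda>v. (\<sigma> (w + v), u (w + v))) 0" for u
    by (simp add: coding_radius_gt_iff nbhd_zgrid)
  then have "{u \<in> space iid. enat r < coding_radius A (\<lambda>v. (\<sigma> v, u v)) w}
      = {u \<in> space iid. (\<lambda>v. u (w + v)) \<in> E}"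
    by (auto simp: E_def space_iid)
  then have "emeasure iid {u \<in> space iid. enat r < coding_radius A (\<lambda>v. (\<sigma> v, u v)) w} = emeasure iid E"
    using emeasure_reindex[of "(+) w" E] E by (simp add: iid_PiM)
  also have "\<dots> \<le> prob_beyond S A r"
    unfolding prob_beyond_def E_def by (rule SUP_upper2[of "\<lambda>v. \<sigma> (w + v)"]) (use \<sigma> in auto)
  finally show ?thesis .
qed

text \<open>Derandomization: a single assignment of random numbers to identifiers serves all
  neighbourhoods at once, as there are too few of them for the union bound to fail.\<close>

lemma exists_seed:
  fixes A :: "('d::finite, 'i, 'o) ualg" and L :: "('d, 'i, 'o) lcl"
  defines "S \<equiv> in_labels L"
  assumes A: "is_ualg S T A" and solves: "usolves A L" and S: "finite S" "i0 \<in> S"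
    and \<epsilon>: "prob_beyond S A R \<le> ennreal \<epsilon>" "0 \<le> \<epsilon>"
    and t: "t = radius L" and B: "B = zball (R + t)"
    and small: "real (N * card S) ^ card B * real (card (zball t :: (int ^ 'd) set)) * \<epsilon> < 1"
  shows "\<exists>h. \<forall>ident \<sigma>. inj_on ident B \<and> ident ` B \<subseteq> {1..N} \<and> \<sigma> \<in> B \<rightarrow> S \<longrightarrow>
    (\<lambda>x\<in>zball t. (\<sigma> x, truncated_output A o0 R (\<lambda>y. (\<sigma> (x + y), h (ident (x + y)))))) \<in> allowed L"
proof -
  \<comment> \<open>One random number for each identifier and one for each vertex. The latter serve
    the vertices outside \<open>B\<close>, so that the whole grid receives independent
    labels.\<close>
  define M :: "(nat + int ^ 'd \<Rightarrow> real) measure" where "M = PiM UNIV (\<lambda>_. unif01)"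
  interpret M: prob_space M unfolding M_def by (rule prob_space_PiM) (rule prob_space_unif01)
  have finB: "finite B" unfolding B by simp
  define good where "good \<sigma> u \<longleftrightarrow> is_coloring L zgrid (\<lambda>v. (\<sigma> v, uoutput A (\<lambda>v. (\<sigma> v, u v)) v))"
    for \<sigma> u
  have "AE u in iid. good \<sigma> u" if "\<sigma> \<in> UNIV \<rightarrow> S" for \<sigma>
    using solves that by (auto simp: usolves_def Let_def good_def S_def elim!: AE_mp)
  then have ex: "\<exists>Z. Z \<in> null_sets iid \<and> {u \<in> space iid. \<not> good \<sigma> u} \<subseteq> Z" if "\<sigma> \<in> UNIV \<rightarrow> S" for \<sigma>
    using that unfolding eventually_ae_filter by blast
  \<comment> \<open>\<open>usolves\<close> speaks of almost all labellings; replacing the failures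
    by a null set that contains them keeps \<open>E\<close> measurable.\<close>
  define Z where "Z \<sigma> = (SOME Z. Z \<in> null_sets iid \<and> {u \<in> space iid. \<not> good \<sigma> u} \<subseteq> Z)" for \<sigma>
  have Z: "Z \<sigma> \<in> null_sets iid" "{u \<in> space iid. \<not> good \<sigma> u} \<subseteq> Z \<sigma>" if "\<sigma> \<in> UNIV \<rightarrow> S" for \<sigma>
    using someI_ex[OF ex[OF that]] by (simp_all add: Z_def)
  define far where "far \<sigma> x = {u \<in> space iid. enat R < coding_radius A (\<lambda>v. (\<sigma> v, u v)) x}" for \<sigma> x
  define E where "E \<sigma> = (\<Union>x\<in>zball t. far \<sigma> x) \<union> Z \<sigma>" for \<sigma>
  have far: "far \<sigma> x \<in> sets iid" if "\<sigma> \<in> UNIV \<rightarrow> S" for \<sigma> x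
    unfolding far_def by (rule sets_coding_radius_gt[where S = S]) (use A that in \<open>auto simp: is_ualg_def\<close>)
  have E: "E \<sigma> \<in> sets iid" if "\<sigma> \<in> UNIV \<rightarrow> S" for \<sigma>
    unfolding E_def using far[OF that] Z(1)[OF that] by (intro sets.Un sets.finite_UN) auto
  have emE: "emeasure iid (E \<sigma>) \<le> ennreal (real (card (zball t :: (int ^ 'd) set)) * \<epsilon>)"
    if \<sigma>: "\<sigma> \<in> UNIV \<rightarrow> S" for \<sigma>
  proof -
    have "emeasure iid (E \<sigma>) = emeasure iid (\<Union>x\<in>zball t. far \<sigma> x)"
      unfolding E_def using far[OF \<sigma>] Z(1)[OF \<sigma>] by (intro emeasure_Un_null_set sets.finite_UN) auto
    also have "\<dots> \<le> (\<Sum>x\<in>zball t. emeasure iid (far \<sigma> x))"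
      using far[OF \<sigma>] by (intro emeasure_subadditive_finite) auto
    also have "\<dots> \<le> (\<Sum>x\<in>(zball t :: (int ^ 'd) set). ennreal \<epsilon>)"
      unfolding far_def
      by (intro sum_mono order_trans[OF emeasure_coding_radius_le[OF A \<sigma>] \<epsilon>(1)])
    also have "\<dots> = ennreal (real (card (zball t :: (int ^ 'd) set)) * \<epsilon>)"
      using \<epsilon>(2) by (subst sum_ennreal) auto
    finally show ?thesis .
  qed
  \<comment> \<open>Only restrictions to \<open>B\<close> are distinguished, which leaves finitely
    many cases for the union bound. \<open>ext\<close> completes an input by \<open>i0\<close> to
    one on the whole grid, where \<open>usolves\<close> applies.\<close>
  define W where "W = {ident \<in> B \<rightarrow>\<^sub>E {1..N}. inj_on ident B} \<times> (B \<rightarrow>\<^sub>E S)"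
  define ext where "ext s x = (if x \<in> B then s x else i0)" for s x
  define \<pi> :: "(int ^ 'd \<Rightarrow> nat) \<Rightarrow> int ^ 'd \<Rightarrow> nat + int ^ 'd" where
    "\<pi> ident x = (if x \<in> B then Inl (ident x) else Inr x)" for ident x
  define F where "F p = {w \<in> space M. (\<lambda>v. w (\<pi> (fst p) v)) \<in> E (ext (snd p))}" for p
  have "finite {ident \<in> B \<rightarrow>\<^sub>E {1..N}. inj_on ident B}"
    by (rule finite_subset[of _ "B \<rightarrow>\<^sub>E {1..N}"]) (use finB in \<open>auto intro: finite_PiE\<close>)
  then have finW: "finite W"
    unfolding W_def using finB S(1) by (intro finite_cartesian_product finite_PiE) auto
  have ext: "ext s \<in> UNIV \<rightarrow> S" if "s \<in> B \<rightarrow>\<^sub>E S" for s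
    using that S(2) by (auto simp: ext_def)
  have inj: "inj (\<pi> ident)" if "inj_on ident B" for ident
    using that by (auto simp: \<pi>_def inj_on_def)
  have W: "inj (\<pi> (fst p))" "ext (snd p) \<in> UNIV \<rightarrow> S" if "p \<in> W" for p
    using that inj[of "fst p"] ext[of "snd p"] by (simp_all add: W_def mem_Times_iff)
  have emF: "emeasure M (F p) \<le> ennreal (real (card (zball t :: (int ^ 'd) set)) * \<epsilon>)" if "p \<in> W" for p
    unfolding F_def M_def emeasure_reindex[OF W(1)[OF that] E[OF W(2)[OF that]]] by (rule emE[OF W(2)[OF that]])
  have F: "F p \<in> sets M" if "p \<in> W" for p
    using measurable_sets[OF measurable_reindex E[OF W(2)[OF that]], of "\<pi> (fst p)"]
    unfolding F_def M_def by (simp add: vimage_def Int_def conj_commute)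
  have "emeasure M (\<Union>p\<in>W. F p) \<le> (\<Sum>p\<in>W. emeasure M (F p))"
    using F finW by (intro emeasure_subadditive_finite) auto
  also have "\<dots> \<le> (\<Sum>p\<in>W. ennreal (real (card (zball t :: (int ^ 'd) set)) * \<epsilon>))"
    by (intro sum_mono emF)
  also have "\<dots> = ennreal (real (card W) * (real (card (zball t :: (int ^ 'd) set)) * \<epsilon>))"
    using \<epsilon>(2) by (subst sum_ennreal) auto
  also have "\<dots> < 1"
  proof -
    have "card W \<le> card ((B \<rightarrow>\<^sub>E {1..N}) \<times> (B \<rightarrow>\<^sub>E S))"
      unfolding W_def using finB S(1) by (intro card_mono finite_cartesian_product finite_PiE) auto
    also have "\<dots> = (N * card S) ^ card B"
      using finB by (simp add: card_cartesian_product card_PiE power_mult_distrib)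
    finally have "real (card W) \<le> real (N * card S) ^ card B" by (metis of_nat_mono of_nat_power)
    then have "real (card W) * (real (card (zball t :: (int ^ 'd) set)) * \<epsilon>)
        \<le> real (N * card S) ^ card B * (real (card (zball t :: (int ^ 'd) set)) * \<epsilon>)"
      using \<epsilon>(2) by (intro mult_right_mono) auto
    also have "\<dots> < 1" using small by (simp add: mult.assoc)
    finally show ?thesis by (simp add: ennreal_less_one_iff)
  qed
  \<comment> \<open>The bad events have total measure below one, so some outcome \<open>w\<close>
    avoids all of them at once; its values at the identifiers are the seed.\<close>
  finally have "emeasure M (\<Union>p\<in>W. F p) < emeasure M (space M)" by (simp add: M.emeasure_space_1)
  then have "\<not> space M \<subseteq> (\<Union>p\<in>W. F p)"
    using F finW by (metis emeasure_mono leD sets.finite_UN)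
  then obtain w where w: "w \<in> space M" "\<And>p. p \<in> W \<Longrightarrow> w \<notin> F p" by blast
  show ?thesis
  proof (rule exI[of _ "\<lambda>j. w (Inl j)"], intro allI impI)
    fix ident and \<sigma> :: "int ^ 'd \<Rightarrow> 'i"
    assume *: "inj_on ident B \<and> ident ` B \<subseteq> {1..N} \<and> \<sigma> \<in> B \<rightarrow> S"
    define \<tau> where "\<tau> = ext (restrict \<sigma> B)"
    define u where "u = (\<lambda>v. w (\<pi> (restrict ident B) v))"
    have "(restrict ident B, restrict \<sigma> B) \<in> W" using * by (auto simp: W_def)
    then have nE: "u \<notin> E \<tau>" and \<tau>: "\<tau> \<in> UNIV \<rightarrow> S"
      using w W(2) by (fastforce simp: F_def \<tau>_def u_def)+
    have u: "u \<in> space iid" using w(1) by (auto simp: M_def space_PiM space_iid u_def PiE_def Pi_def)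
    let ?\<omega> = "\<lambda>v. (\<tau> v, u v)"
    have "good \<tau> u" using Z(2)[OF \<tau>] u nE by (auto simp: E_def)
    then have "nbhd zgrid (\<lambda>v. (\<tau> v, uoutput A ?\<omega> v)) 0 t \<in> allowed L"
      by (auto simp: good_def is_coloring_def t)
    moreover have "nbhd zgrid (\<lambda>v. (\<tau> v, uoutput A ?\<omega> v)) 0 t =
      (\<lambda>x\<in>zball t. (\<sigma> x, truncated_output A o0 R (\<lambda>y. (\<sigma> (x + y), w (Inl (ident (x + y)))))))"
      unfolding nbhd_zgrid
    proof (rule restrict_ext)
      fix x :: "int ^ 'd" assume x: "x \<in> zball t"
      have "x \<in> B" unfolding B using zball_mono[OF x] by simp
      then have "\<tau> x = \<sigma> x" by (simp add: \<tau>_def ext_def)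
      moreover have "truncated_output A o0 R (\<lambda>y. (\<sigma> (x + y), w (Inl (ident (x + y))))) = uoutput A ?\<omega> x"
      proof (rule truncated_output_eq)
        show "\<not> enat R < coding_radius A ?\<omega> x" using nE x u by (auto simp: E_def far_def)
        fix y :: "int ^ 'd" assume "y \<in> zball R"
        then have "x + y \<in> B" unfolding B using zball_add[OF x, of y R] by (simp add: add.commute[of t])
        then show "(\<sigma> (x + y), w (Inl (ident (x + y)))) = (\<tau> (x + y), u (x + y))"
          by (simp add: \<tau>_def ext_def u_def \<pi>_def)
      qed
      ultimately show "(\<tau> (0 + x), uoutput A ?\<omega> (0 + x)) =
        (\<sigma> x, truncated_output A o0 R (\<lambda>y. (\<sigma> (x + y), w (Inl (ident (x + y))))))" by simp
    qed
    ultimately show "(\<lambda>x\<in>zball t. (\<sigma> x, truncated_output A o0 R (\<lambda>y. (\<sigma> (x + y), w (Inl (ident (x + y)))))))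
      \<in> allowed L" by simp
  qed
qed

lemma log_star_double_exp: "log_star (2 ^ (2 ^ n)) = Suc (Suc (log_star (real n)))" if "n \<ge> 1"
  using that log_star_rec[of "2 ^ (2 ^ n)"] by (simp add: log_star_rec log_pow_cancel)

text \<open>Even with the crude estimate \<open>R n \<le> C * (n + 3)\<close>, the binary logarithm
  of the count is polynomial in \<open>n\<close>, against the exponent \<open>2 ^ n\<close> in the
  failure probability. The constant \<open>b\<close> is such that
  \<open>2 * (R n + t) + 1 \<le> b * (n + 1)\<close>.\<close>

lemma eventually_few_neighbourhoods:
  fixes C :: real and k s t :: nat
  assumes "C > 0" and R: "\<And>n. R n = nat \<lfloor>C * real (log_star (2 ^ (2 ^ n)))\<rfloor>"
  shows "\<forall>\<^sub>F n in sequentially. real (n ^ k * s) ^ card (zball (R n + t) :: (int ^ 'd::finite) set)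
    * real (card (zball t :: (int ^ 'd) set)) * (1 / 2 ^ (2 ^ n)) < 1"
proof -
  define d where "d = CARD('d)"
  define c where "c = real (card (zball t :: (int ^ 'd) set))"
  define b where "b = 2 * (3 * C + real t) + 1"
  have "b > 0" using \<open>C > 0\<close> by (simp add: b_def)
  then have "\<forall>\<^sub>F n in sequentially. (real n * real k + real s) * (b * (real n + 1)) ^ d + c < 2 ^ n"
    by real_asymp
  then show ?thesis
    using eventually_ge_at_top[of 1]
  proof eventually_elim
    case (elim n)
    define m where "m = card (zball (R n + t) :: (int ^ 'd) set)"
    have "real (log_star (2 ^ (2 ^ n))) \<le> real n + 3"
      using log_star_le_linear[of "real n"] elim by (simp add: log_star_double_exp)
    then have "real (R n) \<le> C * (real n + 3)"
      unfolding R using \<open>C > 0\<close> by (smt (verit) mult_left_mono of_int_floor_le of_nat_0_le_iff mult_nonneg_nonneg of_nat_nat zero_le_floor)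
    moreover have "C * (real n + 3) \<le> 3 * C * (real n + 1)" using \<open>C > 0\<close> by (simp add: algebra_simps)
    moreover have "real t \<le> real t * (real n + 1)" using mult_left_mono[of 1 "real n + 1" "real t"] by simp
    moreover have "b * (real n + 1) = 2 * (3 * C * (real n + 1)) + 2 * (real t * (real n + 1)) + (real n + 1)"
      by (simp add: b_def algebra_simps)
    ultimately have "2 * real (R n + t) + 1 \<le> b * (real n + 1)" by simp
    then have "(2 * real (R n + t) + 1) ^ d \<le> (b * (real n + 1)) ^ d" by (intro power_mono) auto
    moreover have "real m \<le> (2 * real (R n + t) + 1) ^ d"
    proof -
      have "real m \<le> real ((2 * (R n + t) + 1) ^ d)"
        unfolding m_def d_def by (intro of_nat_mono card_zball_le)
      then show ?thesis by (simp add: add.commute)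
    qed
    ultimately have m: "real m \<le> (b * (real n + 1)) ^ d" by simp
    have "real (n ^ k * s) \<le> 2 ^ (n * k + s)"
    proof -
      have "n ^ k \<le> (2 ^ n) ^ k" "s \<le> 2 ^ s" by (auto intro: power_mono less_imp_le[OF less_exp])
      then have "n ^ k * s \<le> (2 ^ n) ^ k * 2 ^ s" by (rule mult_mono) auto
      then have "real (n ^ k * s) \<le> real ((2 ^ n) ^ k * 2 ^ s)" by (rule of_nat_mono)
      then show ?thesis by (simp add: power_add power_mult)
    qed
    then have "real (n ^ k * s) ^ m \<le> (2 ^ (n * k + s)) ^ m" by (intro power_mono) auto
    then have 1: "real (n ^ k * s) ^ m \<le> 2 ^ ((n * k + s) * m)" by (simp add: power_mult)
    have 2: "c \<le> 2 ^ card (zball t :: (int ^ 'd) set)"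
      unfolding c_def using less_exp[of "card (zball t :: (int ^ 'd) set)"]
      by (metis less_imp_le of_nat_less_iff of_nat_numeral of_nat_power)
    have "(n * k + s) * m + card (zball t :: (int ^ 'd) set) < 2 ^ n"
    proof -
      have "real ((n * k + s) * m + card (zball t :: (int ^ 'd) set))
          = (real n * real k + real s) * real m + c" by (simp add: c_def)
      also have "\<dots> \<le> (real n * real k + real s) * (b * (real n + 1)) ^ d + c"
        using m by (intro add_right_mono mult_left_mono) auto
      also have "\<dots> < real (2 ^ n)" using elim by simp
      finally show ?thesis by (simp only: of_nat_less_iff)
    qed
    then have 3: "(2::real) ^ ((n * k + s) * m + card (zball t :: (int ^ 'd) set)) < 2 ^ (2 ^ n)"
      by (intro power_strict_increasing) auto
    have "real (n ^ k * s) ^ m * c \<le> 2 ^ ((n * k + s) * m) * 2 ^ card (zball t :: (int ^ 'd) set)"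
      by (intro mult_mono 1 2) (auto simp: c_def)
    also have "\<dots> < 2 ^ (2 ^ n)" using 3 by (simp add: power_add)
    finally show ?case unfolding m_def c_def by simp
  qed
qed

theorem ULOCAL_imp_LOCAL:
  fixes L :: "('d::finite, 'i, 'o) lcl"
  assumes L: "L \<in> ULOCAL_O (\<lambda>\<epsilon>. real (log_star (1 / \<epsilon>)))"
  shows "L \<in> LOCAL_O K k (\<lambda>n. real (log_star (real n)))"
proof -
  obtain C A where C: "C > 0" and lcl: "is_lcl L" and A: "is_ualg (in_labels L) (out_labels L) A"
    and solves: "usolves A L" and ev: "\<forall>\<^sub>F \<epsilon> in at_right 0.
      prob_beyond (in_labels L) A (nat \<lfloor>C * real (log_star (1 / \<epsilon>))\<rfloor>) \<le> ennreal \<epsilon>"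
    using L by (auto simp: ULOCAL_O_def ULOCAL_def)
  define S where "S = in_labels L"
  define t where "t = radius L"
  have "finite S" using lcl by (simp add: S_def is_lcl_def)
  define R where "R n = nat \<lfloor>C * real (log_star (2 ^ (2 ^ n)))\<rfloor>" for n :: nat
  have "filterlim (\<lambda>n. 1 / 2 ^ (2 ^ n) :: real) (at_right 0) sequentially" by real_asymp
  from eventually_compose_filterlim[OF ev this]
  have "\<forall>\<^sub>F n in sequentially. prob_beyond S A (R n) \<le> ennreal (1 / 2 ^ (2 ^ n))"
    by (simp add: R_def S_def)
  with eventually_few_neighbourhoods[OF C R_def, of k "card S" t, where 'd = 'd]
  have "\<forall>\<^sub>F n in sequentially. prob_beyond S A (R n) \<le> ennreal (1 / 2 ^ (2 ^ n)) \<and>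
    real (n ^ k * card S) ^ card (zball (R n + t) :: (int ^ 'd) set)
      * real (card (zball t :: (int ^ 'd) set)) * (1 / 2 ^ (2 ^ n)) < 1"
    by eventually_elim auto
  then obtain n0 where n0: "\<And>n. n \<ge> n0 \<Longrightarrow> prob_beyond S A (R n) \<le> ennreal (1 / 2 ^ (2 ^ n)) \<and>
    real (n ^ k * card S) ^ card (zball (R n + t) :: (int ^ 'd) set)
      * real (card (zball t :: (int ^ 'd) set)) * (1 / 2 ^ (2 ^ n)) < 1"
    unfolding eventually_sequentially by blast
  \<comment> \<open>Small tori contain no ball of radius \<open>f n\<close> that looks like the grid.\<close>
  define f where "f n = (if n < n0 then n else R n + t)" for n
  have "(\<lambda>n. real (f n)) \<in> O(\<lambda>n. real (log_star (real n)))"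
  proof (rule bigoI)
    show "\<forall>\<^sub>F n in sequentially. norm (real (f n)) \<le> (3 * C + t) * norm (real (log_star (real n)))"
      using eventually_ge_at_top[of n0] eventually_ge_at_top[of 2]
    proof eventually_elim
      case (elim n)
      define l where "l = real (log_star (real n))"
      have l: "l \<ge> 1" unfolding l_def using log_star_ge_1[of "real n"] elim by simp
      have "real (log_star (2 ^ (2 ^ n))) = l + 2"
        using elim by (simp add: l_def log_star_double_exp)
      then have "real (R n) \<le> C * (l + 2)"
        unfolding R_def using \<open>C > 0\<close> l by simp
      also have "\<dots> \<le> C * (3 * l)" using C l by (intro mult_left_mono) auto
      finally have "real (R n) \<le> 3 * C * l" by simp
      moreover have "real t \<le> real t * l" using mult_left_mono[OF l, of "real t"] by simp
      ultimately have "real (R n) + real t \<le> (3 * C + real t) * l" by (simp add: algebra_simps)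
      then show ?case using elim by (simp add: f_def l_def)
    qed
  qed
  moreover have "\<exists>A'. is_dalg S (out_labels L) f A' \<and> dsolves K k f A' L"
  \<comment> \<open>Without input labels no torus can be labelled, as it has a vertex. Otherwise
    there is a default input and, because a colouring exists almost surely, a default
    output.\<close>
  proof (cases "S = {}")
    case True
    have *: "((zball r :: (int ^ 'd) set) \<rightarrow>\<^sub>E ({} :: (nat \<times> 'i) set)) = {}" for r
      using zero_in_gball_zgrid by (fastforce simp: PiE_eq_empty_iff)
    have "is_dalg S (out_labels L) f (\<lambda>_ (_ :: int ^ 'd \<Rightarrow> nat \<times> 'i). undefined)"
      using True * by (simp add: is_dalg_def)
    moreover have "dsolves K k f (\<lambda>_ _. undefined) L"
      unfolding dsolves_def Let_def
    proof (intro allI impI, elim conjE)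
      fix m :: "'d \<Rightarrow> nat" and \<sigma> :: "int ^ 'd \<Rightarrow> 'i"
      assume "balanced K m" "\<sigma> \<in> verts (torus m) \<rightarrow> in_labels L"
      moreover from this(1) have "reduce m 0 \<in> verts (torus m)"
        by (intro reduce_in_verts) (auto simp: balanced_def)
      ultimately have "\<sigma> (reduce m 0) \<in> S" unfolding S_def by (rule_tac funcset_mem)
      then show "is_coloring L (torus m) (\<lambda>v. (\<sigma> v, undefined))" using True by simp
    qed
    ultimately show ?thesis by blast
  next
    case False
    then obtain i0 where i0: "i0 \<in> S" by blast
    have "AE u in iid. is_coloring L zgrid (\<lambda>v. (i0, uoutput A (\<lambda>v. (i0, u v)) v))"
      using solves i0 by (auto simp: usolves_def Let_def S_def elim!: AE_mp)
    then have "\<exists>u. is_coloring L zgrid (\<lambda>v. (i0, uoutput A (\<lambda>v. (i0, u v)) v))"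
      by (rule eventually_happens'[rotated])
        (simp add: ae_filter_eq_bot_iff prob_space.emeasure_space_1[OF prob_space_iid])
    then obtain o0 where o0: "o0 \<in> out_labels L" by (auto simp: is_coloring_def)
    define B where "B n = (zball (R n + t) :: (int ^ 'd) set)" for n
    define good where "good n h \<longleftrightarrow> (\<forall>ident \<sigma>. inj_on ident (B n) \<and> ident ` B n \<subseteq> {1..n ^ k} \<and> \<sigma> \<in> B n \<rightarrow> S \<longrightarrow>
      (\<lambda>x\<in>zball t. (\<sigma> x, truncated_output A o0 (R n) (\<lambda>y. (\<sigma> (x + y), h (ident (x + y)))))) \<in> allowed L)"
      for n and h :: "nat \<Rightarrow> real"
    have "\<exists>h. good n h" if "n \<ge> n0" for n
      unfolding good_def S_def B_def
      by (rule exists_seed[where \<epsilon> = "1 / 2 ^ (2 ^ n)"])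
        (use A solves \<open>finite S\<close> i0 n0[OF that] in \<open>auto simp: S_def t_def\<close>)
    \<comment> \<open>One seed for each \<open>n\<close>: a deterministic algorithm is told
      \<open>n\<close> and may depend on it arbitrarily.\<close>
    then obtain h where h: "\<And>n. n \<ge> n0 \<Longrightarrow> good n (h n)" by metis
    define A' where "A' n \<zeta> = truncated_output A o0 (R n) (\<lambda>y. (snd (\<zeta> y), h n (fst (\<zeta> y))))"
      for n and \<zeta> :: "int ^ 'd \<Rightarrow> nat \<times> 'i"
    have "is_dalg S (out_labels L) f A'"
      unfolding is_dalg_def A'_def using truncated_output_in[OF A o0] by blast
    moreover have "dsolves K k f A' L"
      unfolding dsolves_def Let_def
    proof (intro allI impI)
      fix m :: "'d \<Rightarrow> nat" and ident and \<sigma> :: "int ^ 'd \<Rightarrow> 'i"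
      define V where "V = verts (torus m)"
      define n where "n = card V"
      assume "balanced K m \<and> (\<forall>v\<in>verts (torus m). grid_like (torus m) v (f (card (verts (torus m))))
          \<and> grid_like (torus m) v (radius L)) \<and> inj_on ident (verts (torus m)) \<and>
        ident ` verts (torus m) \<subseteq> {1..card (verts (torus m)) ^ k} \<and> \<sigma> \<in> verts (torus m) \<rightarrow> in_labels L"
      then have m: "\<And>i. m i > 0" and grid: "\<And>v. v \<in> V \<Longrightarrow> grid_like (torus m) v (f n)"
        "\<And>v. v \<in> V \<Longrightarrow> grid_like (torus m) v t" and ident: "inj_on ident V" "ident ` V \<subseteq> {1..n ^ k}"
        and \<sigma>: "\<sigma> \<in> V \<rightarrow> S"
        by (auto simp: balanced_def V_def n_def t_def S_def)
      have inV: "reduce m x \<in> V" for x unfolding V_def by (rule reduce_in_verts) (rule m)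
      have "n \<ge> n0"
      proof (rule ccontr)
        assume "\<not> n \<ge> n0"
        then have "f n = n" by (simp add: f_def)
        then show False
          using grid(1)[OF inV[of 0]] not_grid_like_large[OF finite_verts_torus, of m n]
          by (simp add: n_def V_def)
      qed
      then have f: "f n = R n + t" by (simp add: f_def)
      let ?out = "\<lambda>v. A' n (nbhd (torus m) (\<lambda>w. (ident w, \<sigma> w)) v (f n))"
      have "nbhd (torus m) (\<lambda>v. (\<sigma> v, ?out v)) v t \<in> allowed L" if v: "v \<in> V" for v
      proof -
        \<comment> \<open>The torus is seen from \<open>v\<close>: pulled back along reduction, its
          identifiers and inputs become labels of \<open>B n\<close>, to which the property of the
          seed applies.\<close>
        define ident' where "ident' x = ident (reduce m (v + x))" for x
        define \<sigma>' where "\<sigma>' x = \<sigma> (reduce m (v + x))" for x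
        have "inj_on ident' (B n)"
          unfolding ident'_def B_def f[symmetric]
          using comp_inj_on[OF inj_on_zball_torus[OF grid(1)[OF v]], of ident] v ident(1) inV
          by (auto simp: V_def o_def intro: inj_on_subset)
        moreover have "ident' ` B n \<subseteq> {1..n ^ k}" using ident(2) inV by (auto simp: ident'_def)
        moreover have "\<sigma>' \<in> B n \<rightarrow> S" using \<sigma> inV by (auto simp: \<sigma>'_def)
        ultimately have "(\<lambda>x\<in>zball t. (\<sigma>' x, truncated_output A o0 (R n)
            (\<lambda>y. (\<sigma>' (x + y), h n (ident' (x + y)))))) \<in> allowed L"
          using h[OF \<open>n \<ge> n0\<close>] unfolding good_def by blast
        moreover have "nbhd (torus m) (\<lambda>v. (\<sigma> v, ?out v)) v t =
          (\<lambda>x\<in>zball t. (\<sigma>' x, truncated_output A o0 (R n) (\<lambda>y. (\<sigma>' (x + y), h n (ident' (x + y))))))"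
          unfolding nbhd_torus[OF grid(2)[OF v] v[unfolded V_def]]
        proof (rule restrict_ext)
          fix x :: "int ^ 'd" assume x: "x \<in> zball t"
          let ?w = "reduce m (v + x)"
          have w: "nbhd (torus m) (\<lambda>w. (ident w, \<sigma> w)) ?w (f n) =
              (\<lambda>y\<in>zball (f n). (ident' (x + y), \<sigma>' (x + y)))"
            unfolding nbhd_torus[OF grid(1)[OF inV] inV[unfolded V_def]]
            by (rule restrict_ext) (simp add: ident'_def \<sigma>'_def reduce_add add.assoc)
          have "?out ?w = truncated_output A o0 (R n) (\<lambda>y. (\<sigma>' (x + y), h n (ident' (x + y))))"
            unfolding w A'_def
            by (rule truncated_output_cong) (use zball_mono[of _ "R n" "f n"] f in auto)
          then show "(\<sigma> ?w, ?out ?w) = (\<sigma>' x, truncated_output A o0 (R n) (\<lambda>y. (\<sigma>' (x + y), h n (ident' (x + y)))))"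
            by (simp add: \<sigma>'_def)
        qed
        ultimately show ?thesis by simp
      qed
      moreover have "?out v \<in> out_labels L" for v
        unfolding A'_def by (rule truncated_output_in[OF A o0])
      ultimately show "is_coloring L (torus m) (\<lambda>v. (\<sigma> v, A' (card (verts (torus m)))
          (nbhd (torus m) (\<lambda>w. (ident w, \<sigma> w)) v (f (card (verts (torus m)))))))"
        using grid(2) \<sigma> unfolding is_coloring_def n_def V_def t_def S_def by auto
    qed
    ultimately show ?thesis by blast
  qed
  ultimately show ?thesis using lcl by (auto simp: LOCAL_O_def LOCAL_def S_def)
qed


section \<open>Distance colourings by colour reduction\<close>

definition mex :: "nat set \<Rightarrow> nat" where
  "mex A = (LEAST c. c \<notin> A)"

lemma mex: "mex A \<notin> A" "mex A \<le> card A" if "finite A"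
proof -
  have "\<not> {..card A} \<subseteq> A" using card_mono[OF that, of "{..card A}"] by auto
  then obtain c where c: "c \<le> card A" "c \<notin> A" by blast
  show "mex A \<notin> A" unfolding mex_def by (rule LeastI[of _ c]) (rule c)
  have "mex A \<le> c" unfolding mex_def by (rule Least_le) (rule c)
  then show "mex A \<le> card A" using c by simp
qed

definition differing_bit :: "nat \<Rightarrow> nat \<Rightarrow> nat" where
  "differing_bit c c' = (if c = c' then 0 else LEAST k. bit c k \<noteq> bit c' k)"

lemma bit_differing_bit: "bit c (differing_bit c c') \<noteq> bit c' (differing_bit c c')" if "c \<noteq> c'"
proof -
  have "\<exists>k. bit c k \<noteq> bit c' k" using that by (auto intro: bit_eqI)
  then have "bit c (LEAST k. bit c k \<noteq> bit c' k) \<noteq> bit c' (LEAST k. bit c k \<noteq> bit c' k)"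
    by (rule LeastI_ex)
  then show ?thesis using that by (simp add: differing_bit_def)
qed

lemma differing_bit_less: "differing_bit c c' < b" if "c < 2 ^ b" "c' < 2 ^ b" "b > 0"
proof (cases "c = c'")
  case False
  have small: "\<not> bit n k" if "n < 2 ^ b" "b \<le> k" for n k :: nat
  proof -
    have "n < 2 ^ k" using that by (meson less_le_trans one_le_numeral power_increasing)
    then show ?thesis by (simp add: bit_iff_odd)
  qed
  show ?thesis using bit_differing_bit[OF False] small that by (meson not_le)
qed (use that in \<open>simp add: differing_bit_def\<close>)

text \<open>\<open>X\<close> lists the displacements across which colours must differ, that is, the
  connection set of a power of the grid; in the application it is the ball of radius
  \<open>m\<close> without its centre. By \<open>a_shrink\<close>, a reduction round takes colours
  of \<open>a (Suc i) + 1\<close> bits to at most \<open>2 ^ a i\<close> colours.\<close>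

locale distance_colouring =
  fixes X :: "(int ^ 'd::finite) set" and m :: nat and a :: "nat \<Rightarrow> nat"
  assumes X_sub: "X \<subseteq> zball m" and X_0: "0 \<notin> X" and X_uminus: "x \<in> X \<Longrightarrow> - x \<in> X"
    and mono_a: "mono a" and a_shrink: "(2 * (a (Suc i) + 1)) ^ card X \<le> 2 ^ a i"
begin

lemma finite_X: "finite X"
  using X_sub finite_subset finite_zball by blast

text \<open>Colourings are partial: \<open>None\<close> marks vertices of other levels during
  reduction, and vertices not yet coloured in the greedy phase.\<close>

definition proper :: "(int ^ 'd \<Rightarrow> nat option) \<Rightarrow> bool" where
  "proper g \<longleftrightarrow> (\<forall>v c. \<forall>x\<in>X. g v = Some c \<longrightarrow> g (v + x) \<noteq> Some c)"

definition bounded_by :: "nat \<Rightarrow> (int ^ 'd \<Rightarrow> nat option) \<Rightarrow> bool" where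
  "bounded_by N g \<longleftrightarrow> (\<forall>v c. g v = Some c \<longrightarrow> c < N)"

text \<open>One round of colour reduction: a vertex points out, for each neighbour, a bit in which its
  colour differs from the colour of that neighbour. If two neighbours had the same new colour, the
  entries for the direction from one to the other would agree, contradicting the choice of the
  bit.\<close>

definition new_colour :: "(int ^ 'd \<Rightarrow> nat option) \<Rightarrow> int ^ 'd \<Rightarrow> int ^ 'd \<Rightarrow> nat \<times> bool" where
  "new_colour g v = (\<lambda>x\<in>X. let c = the (g v);
     k = (case g (v + x) of None \<Rightarrow> 0 | Some c' \<Rightarrow> differing_bit c c') in (k, bit c k))"

definition enc :: "nat \<Rightarrow> (int ^ 'd \<Rightarrow> nat \<times> bool) \<Rightarrow> nat" where
  "enc b = (SOME e. bij_betw e (X \<rightarrow>\<^sub>E {..<b} \<times> UNIV) {0..<(2 * b) ^ card X})"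

lemma bij_betw_enc: "bij_betw (enc b) (X \<rightarrow>\<^sub>E {..<b} \<times> UNIV) {0..<(2 * b) ^ card X}"
proof -
  let ?F = "X \<rightarrow>\<^sub>E {..<b} \<times> (UNIV :: bool set)"
  have "finite ?F" using finite_X by (intro finite_PiE) auto
  moreover have "card ?F = (2 * b) ^ card X"
    using finite_X by (simp add: card_PiE card_cartesian_product mult.commute)
  ultimately have "\<exists>e. bij_betw e ?F {0..<(2 * b) ^ card X}"
    using ex_bij_betw_finite_nat by metis
  then show ?thesis unfolding enc_def by (rule someI_ex)
qed

definition reduce_bits :: "nat \<Rightarrow> (int ^ 'd \<Rightarrow> nat option) \<Rightarrow> int ^ 'd \<Rightarrow> nat option" where
  "reduce_bits b g v = (case g v of None \<Rightarrow> None | Some _ \<Rightarrow> Some (enc b (new_colour g v)))"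

lemma new_colour_in:
  assumes "bounded_by (2 ^ b) g" "b > 0" "g v = Some c"
  shows "new_colour g v \<in> X \<rightarrow>\<^sub>E {..<b} \<times> UNIV"
proof -
  have "(case g (v + x) of None \<Rightarrow> 0 | Some c' \<Rightarrow> differing_bit c c') < b" for x
    using assms differing_bit_less by (auto simp: bounded_by_def split: option.split)
  then show ?thesis using assms(3) by (auto simp: new_colour_def Let_def)
qed

lemma bounded_by_reduce_bits:
  assumes "bounded_by (2 ^ b) g" "b > 0"
  shows "bounded_by ((2 * b) ^ card X) (reduce_bits b g)"
  unfolding bounded_by_def reduce_bits_def
  using new_colour_in[OF assms] bij_betwE[OF bij_betw_enc[of b]] by (fastforce split: option.splits)

lemma proper_reduce_bits:
  assumes g: "bounded_by (2 ^ b) g" "b > 0" and proper: "proper g"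
  shows "proper (reduce_bits b g)"
  unfolding proper_def
proof (intro allI ballI impI notI)
  fix v e x assume x: "x \<in> X" and e: "reduce_bits b g v = Some e" "reduce_bits b g (v + x) = Some e"
  obtain c where c: "g v = Some c" "e = enc b (new_colour g v)"
    using e(1) by (auto simp: reduce_bits_def split: option.splits)
  obtain c' where c': "g (v + x) = Some c'" "e = enc b (new_colour g (v + x))"
    using e(2) by (auto simp: reduce_bits_def split: option.splits)
  have "c \<noteq> c'" using proper x c(1) c'(1) by (auto simp: proper_def)
  have "new_colour g v = new_colour g (v + x)"
    using bij_betw_enc[of b] c c' new_colour_in[OF g] by (metis bij_betw_imp_inj_on inj_onD)
  \<comment> \<open>The entry of \<open>v + x\<close> in direction \<open>x\<close> was chosen
    against a third vertex, but equality of the pairs forces the same bit position, namely one where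
    \<open>c\<close> and \<open>c'\<close> differ.\<close>
  then have "new_colour g v x = new_colour g (v + x) x" by simp
  then have "bit c (differing_bit c c') = bit c' (differing_bit c c')"
    using x c(1) c'(1) by (auto simp: new_colour_def Let_def)
  then show False using bit_differing_bit[OF \<open>c \<noteq> c'\<close>] by simp
qed

text \<open>The index counts down: colours enter at the precision of level \<open>i\<close> and
  every round moves to the preceding precision, so level \<open>i\<close> pays exactly
  \<open>i\<close> rounds.\<close>

primrec reduce_colours :: "nat \<Rightarrow> (int ^ 'd \<Rightarrow> nat option) \<Rightarrow> int ^ 'd \<Rightarrow> nat option" where
  "reduce_colours 0 g = g"
| "reduce_colours (Suc i) g = reduce_colours i (reduce_bits (a (Suc i) + 1) g)"

lemma reduce_colours:
  assumes "bounded_by (2 ^ (a i + 1)) g" "proper g"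
  shows "bounded_by (2 ^ (a 0 + 1)) (reduce_colours i g) \<and> proper (reduce_colours i g)"
  using assms
proof (induction i arbitrary: g)
  case (Suc i)
  let ?g = "reduce_bits (a (Suc i) + 1) g"
  have "bounded_by ((2 * (a (Suc i) + 1)) ^ card X) ?g" by (rule bounded_by_reduce_bits) (use Suc in auto)
  moreover have "(2 * (a (Suc i) + 1)) ^ card X \<le> 2 ^ (a i + 1)" using a_shrink[of i] by simp
  ultimately have "bounded_by (2 ^ (a i + 1)) ?g" unfolding bounded_by_def by (meson less_le_trans)
  moreover have "proper ?g" by (rule proper_reduce_bits) (use Suc in auto)
  ultimately show ?case using Suc.IH by simp
qed simp

lemma zball_X: "x \<in> X \<Longrightarrow> y \<in> zball r \<Longrightarrow> y + x \<in> zball (r + m)"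
  using X_sub zball_add by blast

lemma zball_X': "x \<in> X \<Longrightarrow> m \<le> r \<Longrightarrow> x \<in> zball r"
  using X_sub zball_mono by blast

lemma reduce_colours_local:
  assumes "\<And>y. y \<in> zball (i * m) \<Longrightarrow> g (v + y) = g' (v' + y)"
  shows "reduce_colours i g v = reduce_colours i g' v'"
  using assms
proof (induction i arbitrary: g g')
  case 0
  then show ?case using zero_in_gball_zgrid[of 0] by force
next
  case (Suc i)
  let ?b = "a (Suc i) + 1"
  have "reduce_bits ?b g (v + y) = reduce_bits ?b g' (v' + y)" if y: "y \<in> zball (i * m)" for y
  proof -
    have 0: "g (v + y) = g' (v' + y)" using Suc.prems zball_mono[OF y] by simp
    have "g (v + y + x) = g' (v' + y + x)" if "x \<in> X" for x
      using Suc.prems[of "y + x"] zball_X[OF that y] by (simp add: add.assoc add.commute[of m])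
    then have "new_colour g (v + y) = new_colour g' (v' + y)"
      unfolding new_colour_def by (intro restrict_ext) (simp add: 0)
    then show ?thesis by (simp add: reduce_bits_def 0 split: option.split)
  qed
  then show ?case using Suc.IH by simp
qed

text \<open>This is the state before round \<open>r\<close>. The simultaneous choices within a round
  do no harm if each class \<open>R r\<close> is independent, as \<open>greedy_proper\<close>
  assumes.\<close>

primrec greedy :: "(nat \<Rightarrow> int ^ 'd \<Rightarrow> bool) \<Rightarrow> nat \<Rightarrow> int ^ 'd \<Rightarrow> nat option" where
  "greedy R 0 = (\<lambda>_. None)"
| "greedy R (Suc r) = (\<lambda>v. if R r v then Some (mex {c. \<exists>x\<in>X. greedy R r (v + x) = Some c})
     else greedy R r v)"

lemma finite_neighbour_colours: "finite {c. \<exists>x\<in>X. g (v + x) = Some c}"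
    and card_neighbour_colours: "card {c. \<exists>x\<in>X. g (v + x) = Some c} \<le> card X"
proof -
  have *: "{c. \<exists>x\<in>X. g (v + x) = Some c} \<subseteq> (\<lambda>x. the (g (v + x))) ` X" by force
  show "finite {c. \<exists>x\<in>X. g (v + x) = Some c}" using finite_subset[OF *] finite_X by blast
  show "card {c. \<exists>x\<in>X. g (v + x) = Some c} \<le> card X"
    using card_mono[OF _ *] card_image_le[OF finite_X] finite_X by (meson finite_imageI le_trans)
qed

lemma greedy_le: "greedy R r v = Some c \<Longrightarrow> c \<le> card X"
proof (induction r arbitrary: v c)
  case (Suc r)
  then show ?case
    using mex(2)[OF finite_neighbour_colours[of "greedy R r" v]]
      card_neighbour_colours[of "greedy R r" v]
    by (auto split: if_splits)
qed simp

lemma greedy_proper: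
  assumes "\<And>r v x. R r v \<Longrightarrow> x \<in> X \<Longrightarrow> \<not> R r (v + x)"
  shows "proper (greedy R r)"
proof (induction r)
  case (Suc r)
  have new: "greedy R r (v + x) \<noteq> Some (mex {c. \<exists>x\<in>X. greedy R r (v + x) = Some c})" if "x \<in> X" for v x
    using mex(1)[OF finite_neighbour_colours[of "greedy R r" v]] that by blast
  show ?case
    unfolding proper_def
  proof (intro allI ballI impI)
    fix v c x assume x: "x \<in> X" and c: "greedy R (Suc r) v = Some c"
    \<comment> \<open>For the case that \<open>v + x\<close> is coloured in this round and
      \<open>v\<close> was coloured before: seen from \<open>v + x\<close>, the vertex
      \<open>v\<close> lies in direction \<open>- x\<close>.\<close>
    have "greedy R r (v + x + - x) \<noteq> Some (mex {c. \<exists>y\<in>X. greedy R r (v + x + y) = Some c})"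
      by (rule new[OF X_uminus[OF x]])
    then have "greedy R r v \<noteq> Some (mex {c. \<exists>y\<in>X. greedy R r (v + x + y) = Some c})" by simp
    then show "greedy R (Suc r) (v + x) \<noteq> Some c"
      using c new[OF x, of v] assms[OF _ x, of r v] Suc.IH x unfolding proper_def by (auto split: if_splits)
  qed
qed (simp add: proper_def)

lemma greedy_stable:
  assumes "\<And>r s v. R r v \<Longrightarrow> R s v \<Longrightarrow> r = s" "R s v" "s < r"
  shows "greedy R r v = greedy R (Suc s) v"
  using assms(3)
proof (induction r)
  case (Suc r)
  then show ?case using assms(1)[OF assms(2), of r] by (cases "r = s") auto
qed simp

lemma greedy_local:
  assumes "\<And>y s. y \<in> zball (r * m) \<Longrightarrow> s < r \<Longrightarrow> R s (v + y) = R' s (v' + y)"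
  shows "greedy R r v = greedy R' r v'"
  using assms
proof (induction r arbitrary: v v')
  case (Suc r)
  have *: "greedy R r (v + x) = greedy R' r (v' + x)" if x: "x = 0 \<or> x \<in> X" for x :: "int ^ 'd"
  proof (rule Suc.IH)
    fix y :: "int ^ 'd" and s assume y: "y \<in> zball (r * m)" "s < r"
    have "x \<in> zball m" using x X_sub zero_in_gball_zgrid by auto
    then have "y + x \<in> zball (Suc r * m)" using zball_add[OF y(1)] by (simp add: add.commute)
    then show "R s (v + x + y) = R' s (v' + x + y)"
      using Suc.prems[of "y + x" s] y by (simp add: add_ac)
  qed
  have "R r v = R' r v'" using Suc.prems[of 0 r] zero_in_gball_zgrid by auto
  moreover have "{c. \<exists>x\<in>X. greedy R r (v + x) = Some c} = {c. \<exists>x\<in>X. greedy R' r (v' + x) = Some c}"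
    using * by auto
  ultimately show ?case using *[of 0] by simp
qed simp

text \<open>The level of a vertex is the first precision at which the digits of its label distinguish it
  from its neighbours. The vertices of level \<open>i\<close> start with these digits as colours and reduce
  their number to a constant in \<open>i\<close> rounds, and then all vertices are coloured greedily in the
  lexicographic order of levels and reduced colours.\<close>

definition separated :: "nat \<Rightarrow> (int ^ 'd \<Rightarrow> real) \<Rightarrow> int ^ 'd \<Rightarrow> bool" where
  "separated i u v \<longleftrightarrow> (\<forall>x\<in>X. digits (a i) (u v) \<noteq> digits (a i) (u (v + x)))"

definition has_level :: "nat \<Rightarrow> (int ^ 'd \<Rightarrow> real) \<Rightarrow> int ^ 'd \<Rightarrow> bool" where
  "has_level i u v \<longleftrightarrow> separated i u v \<and> (\<forall>j<i. \<not> separated j u v)"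

definition below_level :: "nat \<Rightarrow> (int ^ 'd \<Rightarrow> real) \<Rightarrow> int ^ 'd \<Rightarrow> bool" where
  "below_level k u v \<longleftrightarrow> (\<exists>i<k. separated i u v)"

definition level_colour :: "nat \<Rightarrow> (int ^ 'd \<Rightarrow> real) \<Rightarrow> int ^ 'd \<Rightarrow> nat option" where
  "level_colour i u v = (if has_level i u v then Some (digits (a i) (u v)) else None)"

text \<open>Level 0 is not reduced and has \<open>2 ^ a 0 + 1\<close> colours; rounding up to a
  power of two accommodates every level.\<close>

definition palette :: nat where
  "palette = 2 ^ (a 0 + 1)"

text \<open>Level and reduced colour are packed into one number in base \<open>palette\<close>,
  which turns their lexicographic order into that of the naturals.\<close>

definition has_rank :: "(int ^ 'd \<Rightarrow> real) \<Rightarrow> nat \<Rightarrow> int ^ 'd \<Rightarrow> bool" where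
  "has_rank u r v \<longleftrightarrow>
     reduce_colours (r div palette) (level_colour (r div palette) u) v = Some (r mod palette)"

text \<open>Levels may be unbounded over the grid, so the greedy process need not have a last round.
  The colour is read off right after the vertex's own round; by \<open>greedy_stable\<close> it does
  not change later.\<close>

definition colour :: "(int ^ 'd \<Rightarrow> real) \<Rightarrow> int ^ 'd \<Rightarrow> nat" where
  "colour u v = (let r = LEAST r. has_rank u r v in the (greedy (has_rank u) (Suc r) v))"

lemma below_level_iff: "below_level k u v \<longleftrightarrow> (\<exists>i<k. has_level i u v)"
proof
  assume "below_level k u v"
  then obtain i where i: "i < k" "separated i u v" by (auto simp: below_level_def)
  define j where "j = (LEAST j. separated j u v)"
  have "has_level j u v"
    unfolding has_level_def j_def
    using LeastI[of "\<lambda>j. separated j u v", OF i(2)] not_less_Least[of _ "\<lambda>j. separated j u v"] by blast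
  moreover have "j \<le> i" unfolding j_def by (rule Least_le) (rule i)
  ultimately show "\<exists>i<k. has_level i u v" using i(1) by (meson le_less_trans)
qed (auto simp: below_level_def has_level_def)

lemma has_level_unique: "has_level i u v \<Longrightarrow> has_level j u v \<Longrightarrow> i = j"
  unfolding has_level_def by (meson linorder_neqE_nat)

lemma reduce_colours_eq_None_iff: "reduce_colours i g v = None \<longleftrightarrow> g v = None"
  by (induction i arbitrary: g) (auto simp: reduce_bits_def split: option.splits)

lemma has_rank_level: "has_level (r div palette) u v" if "has_rank u r v"
  using that reduce_colours_eq_None_iff[of "r div palette" "level_colour (r div palette) u" v]
  by (auto simp: has_rank_def level_colour_def split: if_splits)

lemma has_rank_unique: "r = s" if "has_rank u r v" "has_rank u s v"
proof -
  have "r div palette = s div palette" by (meson has_level_unique has_rank_level that)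
  then show ?thesis using that unfolding has_rank_def by (metis div_mult_mod_eq option.inject)
qed

lemma Least_has_rank: "(LEAST r. has_rank u r v) = r" if "has_rank u r v"
  using that has_rank_unique by (metis (mono_tags, lifting) LeastI)

lemma greedy_colour:
  assumes "has_rank u s v" "s < r"
  shows "greedy (has_rank u) r v = Some (colour u v)"
proof -
  have "greedy (has_rank u) r v = greedy (has_rank u) (Suc s) v"
    using assms by (rule greedy_stable[rotated]) (rule has_rank_unique)
  then show ?thesis using assms by (simp add: colour_def Let_def Least_has_rank)
qed

context
  fixes u :: "int ^ 'd \<Rightarrow> real"
  assumes u: "\<And>v. u v \<in> {0..1}"
begin

lemma level_colour: "bounded_by (2 ^ (a i + 1)) (level_colour i u)" "proper (level_colour i u)"
proof -
  have "digits (a i) (u v) < 2 ^ (a i + 1)" for v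
    using digits_le[OF u, of "a i" v] by (simp add: le_less_trans)
  then show "bounded_by (2 ^ (a i + 1)) (level_colour i u)"
    by (auto simp: bounded_by_def level_colour_def split: if_splits)
  show "proper (level_colour i u)"
    unfolding proper_def level_colour_def has_level_def separated_def by (auto split: if_splits)
qed

text \<open>Each level contributes only \<open>palette\<close> ranks, so the number of greedy rounds
  is linear in the level; with unreduced digits as ranks it would be exponential in the
  precision.\<close>

lemma has_rank_exists: "\<exists>r < k * palette. has_rank u r v" if below: "below_level k u v"
proof -
  obtain i where i: "i < k" "has_level i u v" using below below_level_iff by blast
  then obtain c where c: "reduce_colours i (level_colour i u) v = Some c"
    using reduce_colours_eq_None_iff[of i "level_colour i u" v] by (auto simp: level_colour_def)
  have "c < palette"
    using reduce_colours[OF level_colour, of i] c by (auto simp: bounded_by_def palette_def)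
  then have "has_rank u (i * palette + c) v" using c by (simp add: has_rank_def)
  moreover have "i * palette + c < k * palette"
  proof -
    have "i * palette + c < Suc i * palette" using \<open>c < palette\<close> by simp
    also have "\<dots> \<le> k * palette" using i by (intro mult_right_mono) auto
    finally show ?thesis .
  qed
  ultimately show ?thesis by blast
qed

lemma has_rank_independent: "has_rank u r v \<Longrightarrow> x \<in> X \<Longrightarrow> \<not> has_rank u r (v + x)"
  using reduce_colours[OF level_colour, of "r div palette"]
  unfolding has_rank_def proper_def by blast

lemma colour_le: "colour u v \<le> card X" if "below_level k u v"
  using has_rank_exists[OF that] greedy_colour greedy_le by (meson lessI)

text \<open>After \<open>k * palette\<close> rounds both vertices hold their final colours, and
  every state of the greedy process is proper.\<close>

lemma colour_neq:
  assumes "below_level k u v" "below_level k u (v + x)" "x \<in> X"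
  shows "colour u v \<noteq> colour u (v + x)"
proof -
  obtain r s where r: "r < k * palette" "has_rank u r v" "s < k * palette" "has_rank u s (v + x)"
    using has_rank_exists assms by blast
  have "proper (greedy (has_rank u) (k * palette))"
    by (rule greedy_proper) (rule has_rank_independent)
  then show ?thesis
    using greedy_colour[OF r(2,1)] greedy_colour[OF r(4,3)] assms(3) unfolding proper_def by metis
qed

end

text \<open>Indistinguishability for an algorithm that truncates labels. The two base points allow
  the ball around a vertex to be recentred at the origin, where the rule of a uniform algorithm sees
  it.\<close>

definition agree :: "nat \<Rightarrow> nat \<Rightarrow> (int ^ 'd \<Rightarrow> real) \<Rightarrow> int ^ 'd \<Rightarrow> (int ^ 'd \<Rightarrow> real) \<Rightarrow> int ^ 'd \<Rightarrow> bool"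
  where "agree i r u v u' v' \<longleftrightarrow>
    (\<forall>y\<in>zball r. digits (a i) (u (v + y)) = digits (a i) (u' (v' + y)))"

lemma agree_mono: "agree i r u v u' v' \<Longrightarrow> j \<le> i \<Longrightarrow> s \<le> r \<Longrightarrow> agree j s u v u' v'"
  unfolding agree_def using zball_mono[of _ s r] monoD[OF mono_a, of j i] digits_div by metis

lemma agree_shift: "agree i r u (v + y) u' (v' + y)" if "agree i (r + s) u v u' v'" "y \<in> zball s"
  using that zball_add[OF _ that(2)] by (fastforce simp: agree_def add.assoc add.commute[of y])

lemma separated_local: "agree i m u v u' v' \<Longrightarrow> separated i u v \<longleftrightarrow> separated i u' v'"
  using zball_X'[of _ m] zero_in_gball_zgrid[of m] unfolding agree_def separated_def
  by (metis add.right_neutral order_refl)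

lemma has_level_local: "has_level i u v \<longleftrightarrow> has_level i u' v'" if "agree i m u v u' v'"
  using separated_local[OF agree_mono[OF that]] unfolding has_level_def
  by (metis less_imp_le order_refl)

lemma has_rank_local:
  assumes "agree k (k * m) u v u' v'" "r < k * palette"
  shows "has_rank u r v \<longleftrightarrow> has_rank u' r v'"
proof -
  define i where "i = r div palette"
  have i: "Suc i \<le> k" using assms(2) by (simp add: i_def less_mult_imp_div_less Suc_leI)
  \<comment> \<open>\<open>i\<close> rounds of reduction, one more \<open>m\<close> to determine the
    levels, and \<open>i < k\<close>.\<close>
  then have "i * m + m \<le> k * m" using mult_right_mono[OF i, of m] by simp
  then have ag: "agree i (m + i * m) u v u' v'" using i by (intro agree_mono[OF assms(1)]) auto
  have "reduce_colours i (level_colour i u) v = reduce_colours i (level_colour i u') v'"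
  proof (rule reduce_colours_local)
    fix y :: "int ^ 'd" assume "y \<in> zball (i * m)"
    then have *: "agree i m u (v + y) u' (v' + y)" by (rule agree_shift[OF ag])
    then have "digits (a i) (u (v + y)) = digits (a i) (u' (v' + y))"
      using zero_in_gball_zgrid[of m] unfolding agree_def by (metis add.right_neutral)
    then show "level_colour i u (v + y) = level_colour i u' (v' + y)"
      using has_level_local[OF *] by (simp add: level_colour_def)
  qed
  then show ?thesis by (simp add: has_rank_def i_def)
qed

lemma below_level_local:
  assumes "agree k m u v u' v'"
  shows "below_level k u v \<longleftrightarrow> below_level k u' v'"
  unfolding below_level_def using separated_local[OF agree_mono[OF assms]] by (metis less_imp_le order_refl)

lemma colour_local:
  assumes u: "\<And>v. u v \<in> {0..1}" and below: "below_level k u v"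
    and ag: "agree k (k * ((palette + 1) * m)) u v u' v'"
  shows "colour u v = colour u' v'"
proof -
  obtain r where r: "r < k * palette" "has_rank u r v" using has_rank_exists[OF u below] by blast
  \<comment> \<open>Ranks below \<open>k * palette\<close> are determined within radius
    \<open>k * m\<close>, and each of the \<open>Suc r \<le> k * palette\<close> greedy rounds adds
    \<open>m\<close>.\<close>
  have le: "k * m + Suc r * m \<le> k * ((palette + 1) * m)"
    using r(1) mult_right_mono[of "Suc r" "k * palette" m] by (simp add: algebra_simps)
  have loc: "has_rank u s (v + y) \<longleftrightarrow> has_rank u' s (v' + y)"
    if "s < Suc r" "y \<in> zball (Suc r * m)" for s y
    by (rule has_rank_local[OF agree_shift[OF agree_mono[OF ag order_refl le] that(2)]]) (use that r in simp)
  have "has_rank u' r v'" using loc[of r 0] r(2) zero_in_gball_zgrid by auto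
  moreover have "greedy (has_rank u) (Suc r) v = greedy (has_rank u') (Suc r) v'"
    by (rule greedy_local) (use loc in blast)
  ultimately show ?thesis
    using r(2) by (simp only: colour_def Let_def Least_has_rank)
qed

end


section \<open>From deterministic to uniform algorithms\<close>

lemma self_le_tower: "i \<le> tower i"
proof (induction i)
  case (Suc i)
  have "Suc i \<le> Suc (tower i)" using Suc by simp
  also have "\<dots> \<le> 2 ^ tower i" by (rule Suc_leI) (rule less_exp)
  finally show ?case by simp
qed simp

text \<open>With \<open>a i = E * (tower i + h)\<close> the next precision is linear in
  \<open>2 ^ tower i\<close>, while \<open>2 ^ a i\<close> is the \<open>E\<close>-th power of
  \<open>2 ^ (tower i + h)\<close>; \<open>h\<close> absorbs the constants. Taking
  \<open>E = D + 1\<close> keeps it positive when \<open>D = 0\<close>.\<close>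

lemma exists_precisions:
  "\<exists>a. mono a \<and> (\<forall>i. (2 * (a (Suc i) + 1)) ^ D \<le> (2::nat) ^ a i) \<and> (\<forall>i. tower i \<le> a i)"
proof -
  define E where "E = D + 1"
  have "\<forall>\<^sub>F h in sequentially. 2 * real E + 2 * real E * real h + 2 \<le> 2 ^ h" by real_asymp
  then obtain h where "2 * real E + 2 * real E * real h + 2 \<le> 2 ^ h"
    unfolding eventually_sequentially by blast
  then have "real (2 * E + 2 * E * h + 2) \<le> real (2 ^ h)" by simp
  then have h: "2 * E + 2 * E * h + 2 \<le> 2 ^ h" by (simp only: of_nat_le_iff)
  define a where "a i = E * (tower i + h)" for i
  have "(2 * (a (Suc i) + 1)) ^ D \<le> (2::nat) ^ a i" for i
  proof -
    have "2 * (a (Suc i) + 1) \<le> 2 ^ tower i * (2 * E + 2 * E * h + 2)"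
      using mult_right_mono[of 1 "2 ^ tower i" "2 * E * h + 2"] by (simp add: a_def algebra_simps)
    also have "\<dots> \<le> 2 ^ tower i * 2 ^ h" using h by (rule mult_left_mono) simp
    also have "\<dots> = 2 ^ (tower i + h)" by (simp add: power_add)
    finally have "(2 * (a (Suc i) + 1)) ^ E \<le> (2 ^ (tower i + h)) ^ E" by (rule power_mono) simp
    moreover have "(2 * (a (Suc i) + 1)) ^ D \<le> (2 * (a (Suc i) + 1)) ^ E"
      by (rule power_increasing) (simp_all add: E_def)
    moreover have "((2::nat) ^ (tower i + h)) ^ E = 2 ^ a i"
      unfolding a_def by (simp only: power_mult[symmetric] mult.commute)
    ultimately show ?thesis by (simp only: order_trans)
  qed
  moreover have "mono a" unfolding a_def
    by (intro monoI mult_left_mono add_right_mono monoD[OF mono_tower]) auto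
  moreover have "tower i \<le> a i" for i by (simp add: a_def E_def)
  ultimately show ?thesis by blast
qed

text \<open>Completes identifiers given on one ball to a whole torus: at least as many values are
  free as vertices remain.\<close>

lemma exists_inj_extension:
  assumes V: "finite V" "P \<subseteq> V" and Y: "finite Y" "card V \<le> card Y"
    and g: "inj_on g P" "g ` P \<subseteq> Y"
  shows "\<exists>g'. inj_on g' V \<and> g' ` V \<subseteq> Y \<and> (\<forall>x\<in>P. g' x = g x)"
proof -
  have "finite P" using V finite_subset by blast
  then have "card (V - P) \<le> card (Y - g ` P)"
    using V Y g by (simp add: card_Diff_subset card_image)
  then obtain h where h: "h ` (V - P) \<subseteq> Y - g ` P" "inj_on h (V - P)"
    using card_le_inj[of "V - P" "Y - g ` P"] V Y by auto
  have "inj_on (\<lambda>x. if x \<in> P then g x else h x) V"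
    using g h unfolding inj_on_def by (smt (verit) Diff_iff image_subset_iff image_eqI)
  moreover have "(\<lambda>x. if x \<in> P then g x else h x) ` V \<subseteq> Y" using g h by auto
  ultimately show ?thesis by (intro exI[of _ "\<lambda>x. if x \<in> P then g x else h x"]) auto
qed

text \<open>A grid vertex whose neighbourhood carries distinct identifiers cannot tell the grid from a
  torus of side \<open>s\<close>.\<close>

lemma dsolves_on_grid:
  fixes L :: "('d::finite, 'i, 'o) lcl" and v :: "int ^ 'd"
  assumes solves: "dsolves K k f A L" and K: "K \<ge> 1" and k: "k \<ge> 1"
    and n: "n = s ^ CARD('d)" and s: "2 * (f n + radius L) + 1 < s"
    and \<sigma>: "\<sigma> \<in> UNIV \<rightarrow> in_labels L"
    and c: "inj_on (\<lambda>x. c (v + x)) (zball (f n + radius L))"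
      "\<And>x. x \<in> zball (f n + radius L) \<Longrightarrow> c (v + x) \<in> {1..n}"
  shows "nbhd zgrid (\<lambda>w. (\<sigma> w, A n (\<lambda>x\<in>zball (f n). (c (w + x), \<sigma> (w + x))))) v (radius L) \<in> allowed L"
proof -
  define t where "t = radius L"
  define B where "B = (zball (f n + t) :: (int ^ 'd) set)"
  \<comment> \<open>A cube with \<open>n\<close> vertices has side exactly the \<open>d\<close>-th
    root of \<open>n\<close>, hence is balanced for every \<open>K \<ge> 1\<close>.\<close>
  define m where "m = (\<lambda>_ :: 'd. s)"
  define V where "V = verts (torus m)"
  have m0: "\<And>i. m i > 0" using s by (simp add: m_def)
  have cardV: "card V = n" by (simp add: V_def card_verts_torus m_def n)
  have finV: "finite V" unfolding V_def by (rule finite_verts_torus)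
  have inV: "reduce m x \<in> V" for x unfolding V_def by (rule reduce_in_verts) (rule m0)
  have grid: "grid_like (torus m) w r" if "w \<in> V" "r \<le> f n + t" for w r
    unfolding grid_like_def
    by (rule exI, rule ball_iso_torus) (use that s in \<open>auto simp: m_def V_def t_def\<close>)
  have bal: "balanced K m"
  proof -
    have "real n powr (1 / real CARD('d)) = real s"
      using s by (simp add: n powr_realpow[symmetric] powr_powr)
    moreover have "real s / K \<le> real s" "real s \<le> K * real s"
      using K mult_right_mono[OF K, of "real s"] by (auto simp: divide_le_eq mult.commute)
    moreover have "m i = s" for i by (simp add: m_def)
    ultimately show ?thesis
      using s cardV by (simp add: balanced_def V_def[symmetric] Let_def)
  qed
  have "reduce m 0 = 0" by (simp add: reduce_def vec_eq_iff)
  then have zero: "0 \<in> V" using inV[of 0] by simp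
  have inj: "inj_on (reduce m) B"
    using inj_on_zball_torus[OF grid[OF zero, of "f n + t"] zero[unfolded V_def]] by (simp add: B_def)
  \<comment> \<open>The window around \<open>v\<close> is laid around the origin of the torus;
    \<open>pos\<close> recovers the displacement from \<open>v\<close>.\<close>
  define pos where "pos = inv_into B (reduce m)"
  have pos: "pos (reduce m x) = x" if "x \<in> B" for x
    unfolding pos_def by (rule inv_into_f_f[OF inj that])
  have "inj_on (\<lambda>w. c (v + pos w)) (reduce m ` B)"
    using c(1) pos by (auto simp: inj_on_def B_def t_def)
  moreover have "(\<lambda>w. c (v + pos w)) ` (reduce m ` B) \<subseteq> {1..n}"
    using c(2) pos by (auto simp: B_def t_def)
  moreover have "reduce m ` B \<subseteq> V" using inV by auto
  ultimately obtain ident where ident: "inj_on ident V" "ident ` V \<subseteq> {1..n}"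
    "\<forall>w\<in>reduce m ` B. ident w = c (v + pos w)"
    using exists_inj_extension[of V "reduce m ` B" "{1..n}" "\<lambda>w. c (v + pos w)"] finV cardV by auto
  define \<tau> where "\<tau> w = \<sigma> (v + pos w)" for w
  have "n ^ 1 \<le> n ^ k" using k s m0 n by (intro power_increasing) auto
  then have "ident ` V \<subseteq> {1..n ^ k}" using ident(2) by auto
  moreover have "\<tau> \<in> V \<rightarrow> in_labels L" using \<sigma> by (auto simp: \<tau>_def)
  moreover have "\<forall>w\<in>V. grid_like (torus m) w (f n) \<and> grid_like (torus m) w t" using grid by simp
  ultimately have "is_coloring L (torus m) (\<lambda>w. (\<tau> w, A n (nbhd (torus m) (\<lambda>w. (ident w, \<tau> w)) w (f n))))"
    using solves[unfolded dsolves_def Let_def, rule_format, of m ident \<tau>] bal ident(1) cardV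
    by (simp add: V_def t_def)
  then have "nbhd (torus m) (\<lambda>w. (\<tau> w, A n (nbhd (torus m) (\<lambda>w. (ident w, \<tau> w)) w (f n)))) 0 t \<in> allowed L"
    using zero by (auto simp: is_coloring_def V_def t_def)
  moreover have "nbhd (torus m) (\<lambda>w. (\<tau> w, A n (nbhd (torus m) (\<lambda>w. (ident w, \<tau> w)) w (f n)))) 0 t
      = nbhd zgrid (\<lambda>w. (\<sigma> w, A n (\<lambda>x\<in>zball (f n). (c (w + x), \<sigma> (w + x))))) v t"
    unfolding nbhd_zgrid nbhd_torus[OF grid[OF zero, of t, simplified] zero[unfolded V_def]]
  proof (rule restrict_ext)
    fix x :: "int ^ 'd" assume x: "x \<in> zball t"
    have "x \<in> B" unfolding B_def using zball_mono[OF x] by simp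
    then have "\<tau> (reduce m x) = \<sigma> (v + x)" by (simp add: \<tau>_def pos)
    moreover have "nbhd (torus m) (\<lambda>w. (ident w, \<tau> w)) (reduce m x) (f n)
        = (\<lambda>y\<in>zball (f n). (c (v + x + y), \<sigma> (v + x + y)))"
      unfolding nbhd_torus[OF grid[OF inV, of "f n", simplified] inV[unfolded V_def]]
    proof (rule restrict_ext)
      fix y :: "int ^ 'd" assume "y \<in> zball (f n)"
      then have "x + y \<in> B" unfolding B_def using zball_add[OF x] by (metis add.commute)
      then show "(ident (reduce m (reduce m x + y)), \<tau> (reduce m (reduce m x + y)))
          = (c (v + x + y), \<sigma> (v + x + y))"
        using ident(3) by (simp add: reduce_add \<tau>_def pos add.assoc)
    qed
    ultimately show "(\<tau> (reduce m (0 + x)), A n (nbhd (torus m) (\<lambda>w. (ident w, \<tau> w)) (reduce m (0 + x)) (f n)))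
        = (\<sigma> (v + x), A n (\<lambda>y\<in>zball (f n). (c (v + x + y), \<sigma> (v + x + y))))" by simp
  qed
  ultimately show ?thesis by (simp add: t_def)
qed

lemma is_ualg_digits:
  fixes P :: "nat \<Rightarrow> (int ^ 'd::finite \<Rightarrow> 'i) \<Rightarrow> (int ^ 'd \<Rightarrow> nat) \<Rightarrow> bool"
    and b :: "nat \<Rightarrow> nat"
  defines "p r \<eta> \<equiv> (\<lambda>x\<in>zball r. fst (\<eta> x))" and "q r \<eta> \<equiv> (\<lambda>x\<in>zball r. digits (b r) (snd (\<eta> x)))"
  assumes S: "finite S" and T: "finite T"
    and G: "\<And>r p q. p \<in> zball r \<rightarrow>\<^sub>E S \<Longrightarrow> P r p q \<Longrightarrow> G r p q \<in> T"
  shows "is_ualg S T \<lparr>stops = \<lambda>r. {\<eta> \<in> space (nbhd_space S r). P r (p r \<eta>) (q r \<eta>)},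
    rule = \<lambda>r \<eta>. G r (p r \<eta>) (q r \<eta>)\<rparr>"
  unfolding is_ualg_def ualg.simps
proof (intro allI conjI)
  fix r
  let ?M = "nbhd_space S r :: (int ^ 'd \<Rightarrow> 'i \<times> real) measure"
  let ?stops = "{\<eta> \<in> space ?M. P r (p r \<eta>) (q r \<eta>)}"
  show stops: "?stops \<in> sets ?M"
    unfolding p_def q_def by (rule sets_nbhd_space_digits[OF S])
  have "{\<eta> \<in> space ?M. P r (p r \<eta>) (q r \<eta>) \<and> G r (p r \<eta>) (q r \<eta>) = y} \<in> sets ?M" for y
    unfolding p_def q_def by (rule sets_nbhd_space_digits[OF S])
  moreover have "(\<lambda>\<eta>. G r (p r \<eta>) (q r \<eta>)) -` {y} \<inter> space (restrict_space ?M ?stops)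
      = {\<eta> \<in> space ?M. P r (p r \<eta>) (q r \<eta>) \<and> G r (p r \<eta>) (q r \<eta>) = y}" for y
    by (auto simp: space_restrict_space)
  moreover have "p r \<eta> \<in> zball r \<rightarrow>\<^sub>E S" if "\<eta> \<in> space ?M" for \<eta>
    using that by (auto simp: p_def nbhd_space_def space_PiM space_pair_measure PiE_def Pi_def mem_Times_iff)
  ultimately show "(\<lambda>\<eta>. G r (p r \<eta>) (q r \<eta>)) \<in> restrict_space ?M ?stops \<rightarrow>\<^sub>M count_space T"
    using stops by (subst measurable_count_space_eq2[OF T])
      (auto simp: space_restrict_space sets_restrict_space_iff G)
qed

section \<open>The probability of high levels\<close>

context distance_colouring
begin

lemma below_level_mono: "below_level i u v \<Longrightarrow> i \<le> j \<Longrightarrow> below_level j u v"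
  unfolding below_level_def by (meson less_le_trans)

lemma sets_not_separated: "{u \<in> space iid. \<not> separated i u v} \<in> sets iid" (is ?S)
  and emeasure_not_separated:
    "emeasure iid {u \<in> space iid. \<not> separated i u v} \<le> ennreal (2 * real (card X) / 2 ^ a i)" (is ?E)
proof -
  have eq: "{u \<in> space iid. \<not> separated i u v}
      = (\<Union>x\<in>X. {u \<in> space iid. digits (a i) (u v) = digits (a i) (u (v + x))})"
    by (auto simp: separated_def)
  show ?S unfolding eq using finite_X by (intro sets.finite_UN sets_digits_collision) auto
  have "emeasure iid {u \<in> space iid. \<not> separated i u v}
      \<le> (\<Sum>x\<in>X. emeasure iid {u \<in> space iid. digits (a i) (u v) = digits (a i) (u (v + x))})"
    unfolding eq using finite_X sets_digits_collision by (intro emeasure_subadditive_finite) auto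
  also have "\<dots> \<le> (\<Sum>x\<in>X. ennreal (2 / 2 ^ a i))"
    by (intro sum_mono emeasure_digits_collision) (use X_0 in auto)
  also have "\<dots> = ennreal (2 * real (card X) / 2 ^ a i)"
    by (subst sum_ennreal) (auto simp: mult.commute)
  finally show ?E .
qed

text \<open>A vertex without a level fails at every precision, which has probability at most
  \<open>2 * card X / 2 ^ i\<close> for all \<open>i\<close>, hence zero; there are countably many
  vertices.\<close>

lemma AE_below_level:
  assumes "\<And>i. i \<le> a i"
  shows "AE u in iid. \<forall>v. \<exists>k. below_level k u v"
proof -
  have "AE u in iid. \<exists>k. below_level k u v" for v
  proof -
    let ?N = "{u \<in> space iid. \<forall>i\<in>UNIV. \<not> separated i u v}"
    have N: "?N \<in> sets iid" using sets_not_separated by (intro sets.sets_Collect_countable_Ball) auto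
    have "emeasure iid ?N \<le> ennreal (2 * real (card X) / 2 ^ i)" for i
    proof -
      have "emeasure iid ?N \<le> emeasure iid {u \<in> space iid. \<not> separated i u v}"
        by (intro emeasure_mono sets_not_separated) auto
      also have "\<dots> \<le> ennreal (2 * real (card X) / 2 ^ a i)" by (rule emeasure_not_separated)
      also have "\<dots> \<le> ennreal (2 * real (card X) / 2 ^ i)"
        using assms[of i] by (intro ennreal_leI divide_left_mono power_increasing) auto
      finally show ?thesis .
    qed
    moreover have "(\<lambda>i. ennreal (2 * real (card X) / 2 ^ i)) \<longlonglongrightarrow> ennreal 0"
      by (intro tendsto_ennrealI) real_asymp
    ultimately have "emeasure iid ?N \<le> ennreal 0" by (meson LIMSEQ_le_const)
    then have "?N \<in> null_sets iid" using N by (intro null_setsI) auto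
    then show ?thesis by (rule AE_I') (auto simp: below_level_def)
  qed
  then show ?thesis by (simp add: AE_all_countable)
qed

end

text \<open>\<open>K \<ge> 1\<close> makes cubic tori balanced and \<open>k \<ge> 1\<close> makes
  \<open>{1..n}\<close> a legal range of identifiers, so that \<open>dsolves_on_grid\<close>
  applies.\<close>

theorem LOCAL_imp_ULOCAL:
  fixes L :: "('d::finite, 'i, 'o) lcl"
  assumes L: "L \<in> LOCAL_O K k (\<lambda>n. real (log_star (real n)))" and K: "K \<ge> 1" and k: "k \<ge> 1"
  shows "L \<in> ULOCAL_O (\<lambda>\<epsilon>. real (log_star (1 / \<epsilon>)))"
proof -
  obtain f A where lcl: "is_lcl L" and f: "(\<lambda>n. real (f n)) \<in> O(\<lambda>n. real (log_star (real n)))"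
    and A: "is_dalg (in_labels L) (out_labels L) f A" and solves: "dsolves K k f A L"
    using L by (auto simp: LOCAL_O_def LOCAL_def)
  define S where "S = in_labels L"
  define T where "T = out_labels L"
  define t where "t = radius L"
  define d where "d = CARD('d)"
  have fin: "finite S" "finite T" using lcl by (auto simp: S_def T_def is_lcl_def)
  have "d > 0" by (simp add: d_def)
  \<comment> \<open>\<open>f\<close> is at most logarithmic, so every large side \<open>s\<close>
    works. The factor 4 lets the box of side \<open>4 * (f (s ^ d) + t) + 1\<close>, which bounds
    the number of colours, fit into \<open>n = s ^ d\<close>.\<close>
  obtain s where s: "4 * (f (s ^ d) + t) + 2 \<le> s"
  proof -
    obtain c where c: "c > 0"
      and ev: "\<forall>\<^sub>F n in sequentially. norm (real (f n)) \<le> c * norm (real (log_star (real n)))"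
      using landau_o.bigE[OF f] by blast
    have "filterlim (\<lambda>s::nat. s ^ d) sequentially sequentially"
    proof (rule filterlim_at_top_mono[OF filterlim_ident])
      show "\<forall>\<^sub>F s in sequentially. s \<le> s ^ d"
        using eventually_ge_at_top[of 1] by eventually_elim (use \<open>d > 0\<close> in \<open>auto intro: self_le_power\<close>)
    qed
    from eventually_compose_filterlim[OF ev this]
    have "\<forall>\<^sub>F s in sequentially. real (f (s ^ d)) \<le> c * real (log_star (real (s ^ d)))" by simp
    moreover have "\<forall>\<^sub>F s :: nat in sequentially. 4 * (c * (2 + real d * log 2 (real s)) + real t) + 2 \<le> real s"
      using c \<open>d > 0\<close> by real_asymp
    ultimately have "\<forall>\<^sub>F s in sequentially. 4 * (f (s ^ d) + t) + 2 \<le> s"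
      using eventually_ge_at_top[of 2]
    proof eventually_elim
      case (elim s)
      have "real (log_star (real (s ^ d))) \<le> 2 + real d * log 2 (real s)"
      proof -
        have "real (s ^ d) > 1" using elim(3) \<open>d > 0\<close> by (simp add: one_less_power)
        moreover have "log 2 (real (s ^ d)) = real d * log 2 (real s)"
          using elim(3) by (simp add: log_nat_power)
        moreover have "real d * log 2 (real s) \<ge> 0" using elim(3) by simp
        ultimately show ?thesis
          using log_star_le_linear[of "real d * log 2 (real s)"] by (simp add: log_star_rec)
      qed
      then have "c * real (log_star (real (s ^ d))) \<le> c * (2 + real d * log 2 (real s))"
        using c by (intro mult_left_mono) auto
      then have "real (4 * (f (s ^ d) + t) + 2) \<le> real s" using elim(1,2) by simp
      then show ?case by (simp only: of_nat_le_iff)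
    qed
    then show ?thesis using that unfolding eventually_sequentially by blast
  qed
  define n where "n = s ^ d"
  define F where "F = f n"
  define \<rho> where "\<rho> = F + t"
  \<comment> \<open>Two vertices of a window of radius \<open>\<rho>\<close> have distance at most
    \<open>2 * \<rho>\<close>.\<close>
  define m where "m = 2 * \<rho>"
  define X where "X = (zball m :: (int ^ 'd) set) - {0}"
  have s': "4 * \<rho> + 2 \<le> s" using s by (simp add: \<rho>_def F_def n_def)
  obtain a where a: "mono a" "\<And>i. (2 * (a (Suc i) + 1)) ^ card X \<le> (2::nat) ^ a i" "\<And>i. tower i \<le> a i"
    using exists_precisions[of "card X"] by blast
  interpret distance_colouring X m a
    by unfold_locales (use a zball_uminus in \<open>auto simp: X_def\<close>)
  have "card X + 1 = card (zball m :: (int ^ 'd) set)"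
    unfolding X_def using card_Suc_Diff1[OF finite_zball zero_in_gball_zgrid] by simp
  also have "\<dots> \<le> (2 * m + 1) ^ CARD('d)" by (rule card_zball_le)
  also have "\<dots> \<le> n" unfolding n_def d_def using s' by (intro power_mono) (auto simp: m_def)
  finally have colours: "card X + 1 \<le> n" .

  \<comment> \<open>Stopping happens only at radii \<open>c0 * j\<close>, judged by digits of
    precision \<open>a j\<close>. For \<open>j \<ge> 1\<close> such a radius contains
    \<open>j * ((palette + 1) * m)\<close> around every vertex of \<open>zball F\<close>, as
    \<open>colour_local\<close> requires.\<close>
  define c0 where "c0 = (palette + 1) * m + F + 1"
  define good where "good j u v \<longleftrightarrow> (\<forall>x\<in>zball F. below_level j u (v + x))" for j u v
  \<comment> \<open>Colours start at 0, identifiers at 1.\<close>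
  define out where "out \<sigma> u v = A n (\<lambda>x\<in>zball F. (colour u (v + x) + 1, \<sigma> (v + x)))" for \<sigma> u v
  \<comment> \<open>The algorithm reads only truncated labels: it then factors through a finite set, hence is
    measurable.\<close>
  define lab where "lab r q x = (if x \<in> zball r then real (q x) / 2 ^ a (r div c0) else 0)"
    for r and q :: "int ^ 'd \<Rightarrow> nat" and x
  define P where "P r q \<longleftrightarrow> c0 dvd r \<and> good (r div c0) (lab r q) 0 \<and> (\<forall>x. lab r q x \<in> {0..1})" for r q
  define G where "G r p q = out p (lab r q) 0" for r and p :: "int ^ 'd \<Rightarrow> 'i" and q
  define p where "p r \<eta> = (\<lambda>x\<in>zball r. fst (\<eta> x))" for r and \<eta> :: "int ^ 'd \<Rightarrow> 'i \<times> real"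
  define q where "q r \<eta> = (\<lambda>x\<in>zball r. digits (a (r div c0)) (snd (\<eta> x)))"
    for r and \<eta> :: "int ^ 'd \<Rightarrow> 'i \<times> real"
  define U :: "('d, 'i, 'o) ualg" where
    "U = \<lparr>stops = \<lambda>r. {\<eta> \<in> space (nbhd_space S r). P r (q r \<eta>)}, rule = \<lambda>r \<eta>. G r (p r \<eta>) (q r \<eta>)\<rparr>"
  have c0: "c0 > 0" by (simp add: c0_def)
  \<comment> \<open>Nothing lies below level 0, so radius 0 never stops, and every stopping radius
    is at least \<open>F\<close>, the radius read by \<open>A\<close>.\<close>
  have good_pos: "j \<ge> 1" if "good j u v" for j u v
    using that zero_in_gball_zgrid[of F] by (cases j) (auto simp: good_def below_level_def)
  have radius: "F \<le> r" "j * ((palette + 1) * m) + F \<le> r" if "r = c0 * j" "j \<ge> 1" for r j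
  proof -
    have "j * ((palette + 1) * m) + j * F \<le> r" using that(1) by (simp add: c0_def algebra_simps)
    moreover have "1 * F \<le> j * F" using that(2) by (intro mult_right_mono) auto
    ultimately show "F \<le> r" "j * ((palette + 1) * m) + F \<le> r" by linarith+
  qed
  have outT: "out \<sigma> u v \<in> T" if "\<And>x. x \<in> zball F \<Longrightarrow> \<sigma> (v + x) \<in> S" for \<sigma> u v
  proof -
    have "(\<lambda>x\<in>zball F. (colour u (v + x) + 1, \<sigma> (v + x))) \<in> zball (f n) \<rightarrow>\<^sub>E UNIV \<times> S"
      using that by (auto simp: F_def)
    then show ?thesis using A unfolding is_dalg_def out_def S_def T_def by blast
  qed
  have ualg: "is_ualg S T U"
    unfolding U_def p_def q_def
  proof (rule is_ualg_digits[OF fin])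
    fix r and p :: "int ^ 'd \<Rightarrow> 'i" and q assume p: "p \<in> zball r \<rightarrow>\<^sub>E S" and "P r q"
    then have "F \<le> r" using good_pos radius(1)[of r "r div c0"] by (auto simp: P_def)
    then show "G r p q \<in> T"
      unfolding G_def using p zball_mono[of _ F r] by (intro outT) (auto simp: PiE_mem)
  qed
  have stops_iff: "nbhd zgrid (\<lambda>w. (\<sigma> w, u w)) v r \<in> stops U r \<longleftrightarrow> c0 dvd r \<and> good (r div c0) u v"
    (is "?st \<longleftrightarrow> ?good")
    and rule_eq: "c0 dvd r \<Longrightarrow> good (r div c0) u v \<Longrightarrow> rule U r (nbhd zgrid (\<lambda>w. (\<sigma> w, u w)) v r) = out \<sigma> u v"
    if \<sigma>: "\<sigma> \<in> UNIV \<rightarrow> S" and u: "u \<in> space iid" for \<sigma> u v r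
  proof -
    define \<eta> where "\<eta> = nbhd zgrid (\<lambda>w. (\<sigma> w, u w)) v r"
    define j where "j = r div c0"
    define l where "l = lab r (q r \<eta>)"
    have u01: "u w \<in> {0..1}" for w using u by (simp add: space_iid)
    have \<eta>: "\<eta> \<in> space (nbhd_space S r)"
      unfolding \<eta>_def using measurable_space[OF measurable_iid_nbhd[OF \<sigma>] u] .
    have q: "q r \<eta> x = digits (a j) (u (v + x))" if "x \<in> zball r" for x
      using that by (simp add: q_def \<eta>_def nbhd_zgrid j_def)
    have l01: "l x \<in> {0..1}" for x
    proof -
      have "real (q r \<eta> x) \<le> 2 ^ a j" if "x \<in> zball r"
        unfolding q[OF that] using digits_le[OF u01, of "a j" "v + x"] by (metis of_nat_le_iff of_nat_numeral of_nat_power)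
      then show ?thesis by (simp add: l_def lab_def j_def)
    qed
    \<comment> \<open>The label rebuilt as \<open>q / 2 ^ a j\<close> has exactly \<open>q\<close>
      as its digits at precision \<open>a j\<close>, hence agrees with \<open>u\<close> at every
      precision that matters for levels up to \<open>j\<close>.\<close>
    have ag: "agree j r l 0 u v"
      unfolding agree_def using q by (simp add: l_def lab_def j_def[symmetric] digits_def)
    have good_eq: "good j l 0 \<longleftrightarrow> good j u v" and col_eq: "good j u v \<Longrightarrow> x \<in> zball F \<Longrightarrow> colour l x = colour u (v + x)"
      if "c0 dvd r" for x
    proof -
      have r: "r = c0 * j" using that by (simp add: j_def)
      have agx: "agree j (j * ((palette + 1) * m)) l x u (v + x)" if "x \<in> zball F" "j \<ge> 1" for x
        using agree_shift[OF agree_mono[OF ag order_refl radius(2)[OF r that(2)]] that(1)] by simp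
      have below_eq: "below_level j l x \<longleftrightarrow> below_level j u (v + x)" if x: "x \<in> zball F" for x
      proof (cases "j = 0")
        case True
        then show ?thesis by (simp add: below_level_def)
      next
        case False
        have "m \<le> j * ((palette + 1) * m)" using False by (cases j) auto
        then show ?thesis
          using False by (intro below_level_local agree_mono[OF agx[OF x]]) auto
      qed
      then show ge: "good j l 0 \<longleftrightarrow> good j u v" by (simp add: good_def)
      show "colour l x = colour u (v + x)" if g: "good j u v" and x: "x \<in> zball F"
      proof (rule colour_local)
        show "\<And>v. l v \<in> {0..1}" by (rule l01)
        show "below_level j l x" using g x below_eq[OF x] by (simp add: good_def)
        show "agree j (j * ((palette + 1) * m)) l x u (v + x)" by (rule agx[OF x good_pos[OF g]])
      qed
    qed
    show "?st \<longleftrightarrow> ?good"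
      using \<eta> good_eq l01 unfolding \<eta>_def[symmetric] by (auto simp: U_def P_def l_def[symmetric] j_def[symmetric])
    assume r: "c0 dvd r" and g: "good (r div c0) u v"
    have "F \<le> r" using radius(1)[of r j] good_pos[OF g] r by (simp add: j_def)
    then have "p r \<eta> x = \<sigma> (v + x)" if "x \<in> zball F" for x
      using zball_mono[OF that] by (simp add: p_def \<eta>_def nbhd_zgrid)
    then show "rule U r (nbhd zgrid (\<lambda>w. (\<sigma> w, u w)) v r) = out \<sigma> u v"
      using col_eq[OF r g[folded j_def]] unfolding \<eta>_def[symmetric]
      by (simp add: U_def G_def out_def l_def[symmetric] cong: restrict_cong)
  qed
  have run: "uoutput U (\<lambda>w. (\<sigma> w, u w)) v = out \<sigma> u v" "coding_radius U (\<lambda>w. (\<sigma> w, u w)) v \<le> enat (c0 * j)"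
    if \<sigma>: "\<sigma> \<in> UNIV \<rightarrow> S" and u: "u \<in> space iid" and g: "good j u v" for \<sigma> u v j
  proof -
    let ?\<omega> = "\<lambda>w. (\<sigma> w, u w)"
    have st: "nbhd zgrid ?\<omega> v (c0 * j) \<in> stops U (c0 * j)"
      using stops_iff[OF \<sigma> u] g c0 by simp
    then have ex: "\<exists>r. nbhd zgrid ?\<omega> v r \<in> stops U r" by blast
    define r where "r = (LEAST r. nbhd zgrid ?\<omega> v r \<in> stops U r)"
    have "nbhd zgrid ?\<omega> v r \<in> stops U r" unfolding r_def by (rule LeastI_ex[OF ex])
    then show "uoutput U ?\<omega> v = out \<sigma> u v"
      using uoutput_eq(1)[OF ex] stops_iff[OF \<sigma> u] rule_eq[OF \<sigma> u] unfolding r_def[symmetric] by simp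
    have "r \<le> c0 * j" unfolding r_def by (rule Least_le) (rule st)
    then show "coding_radius U ?\<omega> v \<le> enat (c0 * j)"
      using uoutput_eq(2)[OF ex] unfolding r_def[symmetric] by simp
  qed
  have "i \<le> a i" for i using self_le_tower[of i] a(3)[of i] by simp
  then have AE: "AE u in iid. \<forall>v. \<exists>j. below_level j u v" by (rule AE_below_level)
  have "usolves U L"
    unfolding usolves_def Let_def
  proof
    fix \<sigma> :: "int ^ 'd \<Rightarrow> 'i" assume "\<sigma> \<in> UNIV \<rightarrow> in_labels L"
    then have \<sigma>: "\<sigma> \<in> UNIV \<rightarrow> S" by (simp add: S_def)
    show "AE u in iid. (\<forall>v. coding_radius U (\<lambda>v. (\<sigma> v, u v)) v < \<infinity>) \<and>
      is_coloring L zgrid (\<lambda>v. (\<sigma> v, uoutput U (\<lambda>v. (\<sigma> v, u v)) v))"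
      using AE AE_space
    proof eventually_elim
      case (elim u)
      have u01: "u w \<in> {0..1}" for w using elim(2) by (simp add: space_iid)
      have uniform: "\<exists>j. \<forall>x\<in>zball r. below_level j u (v + x)" for v r
      proof -
        obtain J where J: "\<And>w. below_level (J w) u w" using elim(1) by metis
        have "below_level (Max ((\<lambda>x. J (v + x)) ` zball r)) u (v + x)" if "x \<in> zball r" for x
          by (rule below_level_mono[OF J]) (use that in \<open>auto intro: Max_ge\<close>)
        then show ?thesis by blast
      qed
      have good: "\<exists>j. good j u v" for v unfolding good_def by (rule uniform)
      have out: "uoutput U (\<lambda>v. (\<sigma> v, u v)) v = out \<sigma> u v" for v
        using good run(1)[OF \<sigma> elim(2)] by blast
      have "coding_radius U (\<lambda>v. (\<sigma> v, u v)) v < \<infinity>" for v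
      proof -
        obtain j where "good j u v" using good by blast
        from run(2)[OF \<sigma> elim(2) this] show ?thesis by (rule le_less_trans) simp
      qed
      moreover have "is_coloring L zgrid (\<lambda>v. (\<sigma> v, out \<sigma> u v))"
        unfolding is_coloring_def
      proof (intro ballI conjI)
        fix v :: "int ^ 'd"
        show "(\<sigma> v, out \<sigma> u v) \<in> in_labels L \<times> out_labels L"
          using \<sigma> outT[of \<sigma> v u] by (auto simp: S_def T_def)
        show "grid_like zgrid v (radius L)" unfolding grid_like_def using ball_iso_zgrid by blast
        obtain j where j: "\<And>x. x \<in> zball \<rho> \<Longrightarrow> below_level j u (v + x)" using uniform[of \<rho> v] by blast
        have "colour u (v + x) \<noteq> colour u (v + y)" if "x \<in> zball \<rho>" "y \<in> zball \<rho>" "x \<noteq> y" for x y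
        proof -
          have "y - x \<in> X" using zball_diff[OF that(2,1)] that(3) by (simp add: X_def m_def mult_2)
          then show ?thesis
            using colour_neq[OF u01 j[OF that(1)], of "y - x"] j[OF that(2)] by simp
        qed
        then have "inj_on (\<lambda>x. colour u (v + x) + 1) (zball (f n + radius L))"
          by (auto simp: inj_on_def \<rho>_def F_def t_def)
        moreover have "colour u (v + x) + 1 \<in> {1..n}" if "x \<in> zball (f n + radius L)" for x
          using colour_le[OF u01 j, of x] that colours by (simp add: \<rho>_def F_def t_def)
        ultimately have "nbhd zgrid (\<lambda>w. (\<sigma> w, A n (\<lambda>x\<in>zball (f n). (colour u (w + x) + 1, \<sigma> (w + x))))) v (radius L)
            \<in> allowed L"
          using s' \<sigma> by (intro dsolves_on_grid[OF solves K k, of n s, where c = "\<lambda>w. colour u w + 1"])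
            (auto simp: n_def d_def \<rho>_def F_def t_def S_def)
        then show "nbhd zgrid (\<lambda>v. (\<sigma> v, out \<sigma> u v)) v (radius L) \<in> allowed L"
          by (simp add: out_def F_def)
      qed
      ultimately show ?case by (simp add: out)
    qed
  qed
  moreover have "\<forall>\<^sub>F \<epsilon> in at_right 0.
    prob_beyond S U (nat \<lfloor>real (2 * c0) * real (log_star (1 / \<epsilon>))\<rfloor>) \<le> ennreal \<epsilon>"
  proof -
    \<comment> \<open>Constant of the union bound over the vertices of \<open>zball F\<close> and
      their neighbours.\<close>
    define Q where "Q = real (card (zball F :: (int ^ 'd) set)) * (2 * real (card X))"
    have "\<forall>\<^sub>F j :: nat in sequentially. (Q + 1) * real j \<le> 2 ^ j" by real_asymp
    then obtain j0 where j0: "\<And>j. j \<ge> j0 \<Longrightarrow> (Q + 1) * real j \<le> 2 ^ j"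
      unfolding eventually_sequentially by blast
    have "\<forall>\<^sub>F \<epsilon> in at_right 0. real j0 + 1 < 1 / \<epsilon>" by real_asymp
    then show ?thesis
      using eventually_at_right_less[of 0]
    proof eventually_elim
      case (elim \<epsilon>)
      define l where "l = log_star (1 / \<epsilon>)"
      have l: "1 \<le> l" unfolding l_def by (rule log_star_ge_1) (use elim(1) in linarith)
      have tower: "1 / \<epsilon> \<le> real (tower l)" unfolding l_def by (rule le_tower_log_star)
      have r: "nat \<lfloor>real (2 * c0) * real l\<rfloor> = 2 * c0 * l"
        by (metis floor_of_nat nat_int of_nat_mult)
      have "prob_beyond S U (2 * c0 * l) \<le> ennreal \<epsilon>"
        unfolding prob_beyond_def
      proof (rule SUP_least)
        fix \<sigma> :: "int ^ 'd \<Rightarrow> 'i" assume \<sigma>: "\<sigma> \<in> UNIV \<rightarrow> S"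
        let ?bad = "{u \<in> space iid. enat (2 * c0 * l) < coding_radius U (\<lambda>v. (\<sigma> v, u v)) 0}"
        have "?bad \<subseteq> (\<Union>x\<in>zball F. {u \<in> space iid. \<not> separated l u x})"
        proof
          fix u assume u: "u \<in> ?bad"
          \<comment> \<open>Attempt \<open>Suc l\<close> takes radius
            \<open>c0 * (l + 1) \<le> 2 * c0 * l\<close>, since \<open>l \<ge> 1\<close>. It fails
            only if some vertex of \<open>zball F\<close> is not separated even at
            \<open>a l\<close>, its finest precision.\<close>
          have "\<not> good (Suc l) u 0"
          proof
            assume "good (Suc l) u 0"
            from run(2)[OF \<sigma> _ this] u have "coding_radius U (\<lambda>v. (\<sigma> v, u v)) 0 \<le> enat (c0 * Suc l)" by simp
            also have "c0 * Suc l \<le> c0 * (2 * l)" using l by (intro mult_left_mono) auto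
            then have "enat (c0 * Suc l) \<le> enat (2 * c0 * l)" by (simp add: mult.assoc mult.left_commute)
            finally show False using u by (simp add: not_le[symmetric])
          qed
          then show "u \<in> (\<Union>x\<in>zball F. {u \<in> space iid. \<not> separated l u x})"
            using u by (auto simp: good_def below_level_def)
        qed
        then have "emeasure iid ?bad \<le> emeasure iid (\<Union>x\<in>zball F. {u \<in> space iid. \<not> separated l u x})"
          by (intro emeasure_mono sets.finite_UN sets_not_separated) auto
        also have "\<dots> \<le> (\<Sum>x\<in>zball F. emeasure iid {u \<in> space iid. \<not> separated l u x})"
          using sets_not_separated by (intro emeasure_subadditive_finite) auto
        also have "\<dots> \<le> (\<Sum>x\<in>(zball F :: (int ^ 'd) set). ennreal (2 * real (card X) / 2 ^ a l))"
          by (intro sum_mono emeasure_not_separated)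
        also have "\<dots> = ennreal (Q / 2 ^ a l)"
          by (subst sum_ennreal) (auto simp: Q_def)
        also have "\<dots> \<le> ennreal \<epsilon>"
        proof (rule ennreal_leI)
          \<comment> \<open>\<open>1 / \<epsilon> \<le> tower l\<close> pushes
            \<open>tower l\<close> past the threshold \<open>j0\<close> and also gives
            \<open>tower l * \<epsilon> \<ge> 1\<close>; the gap between \<open>tower l\<close> and
            \<open>2 ^ a l\<close> then absorbs \<open>Q\<close>.\<close>
          have "real j0 \<le> real (tower l)" using elim tower by linarith
          then have "(Q + 1) * real (tower l) \<le> 2 ^ tower l" by (intro j0) simp
          also have "\<dots> \<le> 2 ^ a l" using a(3)[of l] by (intro power_increasing) auto
          finally have 1: "(Q + 1) * real (tower l) \<le> 2 ^ a l" .
          have "Q \<ge> 0" by (simp add: Q_def)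
          then have "Q \<le> (Q + 1) * real (tower l) * \<epsilon>"
            using tower elim(2) mult_mono[of Q "Q + 1" 1 "real (tower l) * \<epsilon>"]
            by (simp add: field_simps)
          also have "\<dots> \<le> 2 ^ a l * \<epsilon>" using 1 elim(2) by (intro mult_right_mono) auto
          finally show "Q / 2 ^ a l \<le> \<epsilon>" by (simp add: field_simps)
        qed
        finally show "emeasure iid ?bad \<le> ennreal \<epsilon>" .
      qed
      then show ?case unfolding l_def[symmetric] r .
    qed
  qed
  ultimately have "L \<in> ULOCAL (\<lambda>\<epsilon>. real (2 * c0) * real (log_star (1 / \<epsilon>)))"
    unfolding ULOCAL_def using lcl ualg by (auto simp: S_def T_def)
  moreover have "real (2 * c0) > 0" using c0 by simp
  ultimately show ?thesis unfolding ULOCAL_O_def by blast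
qed


theorem corollary3p3:
  fixes L :: "('d::finite, 'i, 'o) lcl" and K :: real and k :: nat
  assumes "is_lcl L" and "K \<ge> 1" and "k \<ge> 1"
  shows "L \<in> ULOCAL_O (\<lambda>\<epsilon>. real (log_star (1 / \<epsilon>))) \<longleftrightarrow>
         L \<in> LOCAL_O K k (\<lambda>n. real (log_star (real n)))"
  using ULOCAL_imp_LOCAL LOCAL_imp_ULOCAL[OF _ assms(2,3)] by blast

end
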